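(* Let $(\mathcal X,\mathcal Y,\mathcal Z)$ be a triangulated TTF triple on a triangulated category $(\mathcal D,?[1])$. The following assertions are equivalent: 1) The t-structure $(\mathcal X,\mathcal Y)$ splits. 2) The t-structure $(\mathcal Y,\mathcal Z)$ splits. 3) $\mathcal X=\mathcal Z$. 4) The canonical composition $y\tau_{\mathcal Y}M\xrightarrow{\delta_{\mathcal Y,M}}M\xrightarrow{\eta^{\mathcal Y}_M}y\tau^{\mathcal Y}M$ is an isomorphism for each $M\in\mathcal D$. 5) The canonical composition $y\tau_{\mathcal Y}M\xrightarrow{\delta_{\mathcal Y,M}}M\xrightarrow{\eta^{\mathcal Y}_M}y\tau^{\mathcal Y}M$ is a section for each $M\in\mathcal D$. 6) The canonical composition $y\tau_{\mathcal Y}M\xrightarrow{\delta_{\mathcal Y,M}}M\xrightarrow{\eta^{\mathcal Y}_M}y\tau^{\mathcal Y}M$ is a retraction for each $M\in\mathcal D$.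
   Context: A t-structure on a triangulated category $\mathcal D$ is a pair $(\mathcal U,\mathcal V[1])$, where $\mathcal U,\mathcal V$ are full subcategories closed under isomorphisms such that $\mathcal D(U,V)=0$ for $U\in\mathcal U$, $V\in\mathcal V$; $\mathcal U[1]\subseteq\mathcal U$ and $\mathcal V[-1]\subseteq\mathcal V$; and every $M\in\mathcal D$ lies in a triangle $M_{\mathcal U}\to M\to M^{\mathcal V}\to M_{\mathcal U}[1]$ with $M_{\mathcal U}\in\mathcal U$, $M^{\mathcal V}\in\mathcal V$. A triangulated TTF triple on $\mathcal D$ is a triple $(\mathcal X,\mathcal Y,\mathcal Z)$ of full subcategories such that $(\mathcal X,\mathcal Y)$ and $(\mathcal Y,\mathcal Z)$ are t-structures; then $\mathcal X,\mathcal Y,\mathcal Z$ are triangulated subcategories. The inclusion $y:\mathcal Y\to\mathcal D$ then has a right adjoint $\tau_{\mathcal Y}$, with counit $\delta_{\mathcal Y}$, and a left adjoint $\tau^{\mathcal Y}$, with unit $\eta^{\mathcal Y}$. A t-structure $(\mathcal U,\mathcal V)$ with $\mathcal U,\mathcal V$ triangulated splits if for each $M$ the morphism $M_{\mathcal U}\to M$ in the triangle above is a section (equivalently $M\to M^{\mathcal V}$ is a retraction), so that $M\cong M_{\mathcal U}\oplus M^{\mathcal V}$. *)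

theory Defs
  imports "HOL-Algebra.Group"
begin

section \<open>Categories, functors, adjunctions\<close>

record ('o, 'm) cat =
  Ob :: "'o set"
  Ar :: "'m set"
  Dom :: "'m \<Rightarrow> 'o"
  Cod :: "'m \<Rightarrow> 'o"
  Idn :: "'o \<Rightarrow> 'm"
  Cmp :: "'m \<Rightarrow> 'm \<Rightarrow> 'm" (infixl "\<cdot>\<index>" 70)

text \<open>The composite \<open>g \<cdot>\<^bsub>C\<^esub> f\<close> means first \<open>f\<close>, then \<open>g\<close>.\<close>

definition Hom :: "('o, 'm, 'x) cat_scheme \<Rightarrow> 'o \<Rightarrow> 'o \<Rightarrow> 'm set" where
  "Hom C A B = {f \<in> Ar C. Dom C f = A \<and> Cod C f = B}"

locale category =
  fixes C :: "('o, 'm, 'x) cat_scheme" (structure)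
  assumes Dom_Ob: "f \<in> Ar C \<Longrightarrow> Dom C f \<in> Ob C"
    and Cod_Ob: "f \<in> Ar C \<Longrightarrow> Cod C f \<in> Ob C"
    and Idn_Hom: "A \<in> Ob C \<Longrightarrow> Idn C A \<in> Hom C A A"
    and Cmp_Hom: "\<lbrakk>f \<in> Hom C A B; g \<in> Hom C B B'\<rbrakk> \<Longrightarrow> g \<cdot> f \<in> Hom C A B'"
    and Cmp_Idn: "f \<in> Hom C A B \<Longrightarrow> f \<cdot> Idn C A = f"
    and Idn_Cmp: "f \<in> Hom C A B \<Longrightarrow> Idn C B \<cdot> f = f"
    and Cmp_assoc: "\<lbrakk>f \<in> Hom C A B; g \<in> Hom C B B'; h \<in> Hom C B' B''\<rbrakk>
      \<Longrightarrow> (h \<cdot> g) \<cdot> f = h \<cdot> (g \<cdot> f)"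

definition is_section :: "('o, 'm, 'x) cat_scheme \<Rightarrow> 'm \<Rightarrow> bool" where
  "is_section C f \<longleftrightarrow> f \<in> Ar C \<and>
     (\<exists>g \<in> Hom C (Cod C f) (Dom C f). g \<cdot>\<^bsub>C\<^esub> f = Idn C (Dom C f))"

definition is_retraction :: "('o, 'm, 'x) cat_scheme \<Rightarrow> 'm \<Rightarrow> bool" where
  "is_retraction C f \<longleftrightarrow> f \<in> Ar C \<and>
     (\<exists>g \<in> Hom C (Cod C f) (Dom C f). f \<cdot>\<^bsub>C\<^esub> g = Idn C (Cod C f))"

definition is_isomorphism :: "('o, 'm, 'x) cat_scheme \<Rightarrow> 'm \<Rightarrow> bool" where
  "is_isomorphism C f \<longleftrightarrow> f \<in> Ar C \<and>
     (\<exists>g \<in> Hom C (Cod C f) (Dom C f).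
        g \<cdot>\<^bsub>C\<^esub> f = Idn C (Dom C f) \<and> f \<cdot>\<^bsub>C\<^esub> g = Idn C (Cod C f))"

definition isomorphic :: "('o, 'm, 'x) cat_scheme \<Rightarrow> 'o \<Rightarrow> 'o \<Rightarrow> bool" where
  "isomorphic C A B \<longleftrightarrow> (\<exists>f \<in> Hom C A B. is_isomorphism C f)"

record ('o, 'm, 'p, 'n) func =
  fob :: "'o \<Rightarrow> 'p"
  far :: "'m \<Rightarrow> 'n"

definition id_func :: "('o, 'm, 'o, 'm) func" where
  "id_func = \<lparr>fob = (\<lambda>A. A), far = (\<lambda>f. f)\<rparr>"

definition comp_func ::
    "('p, 'n, 'q, 'k) func \<Rightarrow> ('o, 'm, 'p, 'n) func \<Rightarrow> ('o, 'm, 'q, 'k) func" where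
  "comp_func G F = \<lparr>fob = (\<lambda>A. fob G (fob F A)), far = (\<lambda>f. far G (far F f))\<rparr>"

locale cat_functor = S: category S + T: category T
  for S :: "('o, 'm, 'x) cat_scheme" and T :: "('p, 'n, 'y) cat_scheme" +
  fixes F :: "('o, 'm, 'p, 'n) func"
  assumes fob_Ob: "A \<in> Ob S \<Longrightarrow> fob F A \<in> Ob T"
    and far_Hom: "f \<in> Hom S A B \<Longrightarrow> far F f \<in> Hom T (fob F A) (fob F B)"
    and far_Idn: "A \<in> Ob S \<Longrightarrow> far F (Idn S A) = Idn T (fob F A)"
    and far_Cmp: "\<lbrakk>f \<in> Hom S A B; g \<in> Hom S B B'\<rbrakk>
      \<Longrightarrow> far F (g \<cdot>\<^bsub>S\<^esub> f) = far F g \<cdot>\<^bsub>T\<^esub> far F f"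

locale nat_transformation = F: cat_functor S T F + G: cat_functor S T G
  for S :: "('o, 'm, 'x) cat_scheme" and T :: "('p, 'n, 'y) cat_scheme"
    and F G :: "('o, 'm, 'p, 'n) func" +
  fixes \<phi> :: "'o \<Rightarrow> 'n"
  assumes component_Hom: "A \<in> Ob S \<Longrightarrow> \<phi> A \<in> Hom T (fob F A) (fob G A)"
    and naturality: "f \<in> Hom S A B \<Longrightarrow> \<phi> B \<cdot>\<^bsub>T\<^esub> far F f = far G f \<cdot>\<^bsub>T\<^esub> \<phi> A"

locale nat_isomorphism = nat_transformation S T F G \<phi>
  for S :: "('o, 'm, 'x) cat_scheme" and T :: "('p, 'n, 'y) cat_scheme"
    and F G :: "('o, 'm, 'p, 'n) func" and \<phi> :: "'o \<Rightarrow> 'n" +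
  assumes component_iso: "A \<in> Ob S \<Longrightarrow> is_isomorphism T (\<phi> A)"

locale adjunction =
  unit: nat_transformation S S id_func "comp_func R L" \<eta> +
  counit: nat_transformation T T "comp_func L R" id_func \<epsilon> +
  L: cat_functor S T L + R: cat_functor T S R
  for S :: "('o, 'm, 'x) cat_scheme" and T :: "('p, 'n, 'y) cat_scheme"
    and L :: "('o, 'm, 'p, 'n) func" and R :: "('p, 'n, 'o, 'm) func"
    and \<eta> :: "'o \<Rightarrow> 'm" and \<epsilon> :: "'p \<Rightarrow> 'n" +
  assumes triangle_L: "A \<in> Ob S \<Longrightarrow> \<epsilon> (fob L A) \<cdot>\<^bsub>T\<^esub> far L (\<eta> A) = Idn T (fob L A)"
    and triangle_R: "B \<in> Ob T \<Longrightarrow> far R (\<epsilon> B) \<cdot>\<^bsub>S\<^esub> \<eta> (fob R B) = Idn S (fob R B)"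

text \<open>A full subcategory is given by its set of objects.\<close>

definition full_subcat :: "('o, 'm, 'x) cat_scheme \<Rightarrow> 'o set \<Rightarrow> ('o, 'm) cat" where
  "full_subcat C S = \<lparr>Ob = S, Ar = {f \<in> Ar C. Dom C f \<in> S \<and> Cod C f \<in> S},
     Dom = Dom C, Cod = Cod C, Idn = Idn C, Cmp = Cmp C\<rparr>"

text \<open>Used as a functor from \<open>full_subcat C S\<close> to \<open>C\<close>.\<close>

abbreviation (input) inclusion :: "('o, 'm, 'o, 'm) func" where
  "inclusion \<equiv> id_func"

definition iso_closed :: "('o, 'm, 'x) cat_scheme \<Rightarrow> 'o set \<Rightarrow> bool" where
  "iso_closed C S \<longleftrightarrow> (\<forall>A \<in> S. \<forall>B \<in> Ob C. isomorphic C A B \<longrightarrow> B \<in> S)"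


section \<open>Additive categories\<close>

record ('o, 'm) add_cat = "('o, 'm) cat" +
  Add :: "'m \<Rightarrow> 'm \<Rightarrow> 'm" (infixl "\<plusdot>\<index>" 65)
  Zero :: "'o \<Rightarrow> 'o \<Rightarrow> 'm"

definition hom_group :: "('o, 'm, 'x) add_cat_scheme \<Rightarrow> 'o \<Rightarrow> 'o \<Rightarrow> 'm monoid" where
  "hom_group C A B = \<lparr>carrier = Hom C A B, mult = Add C, one = Zero C A B\<rparr>"

definition Neg :: "('o, 'm, 'x) add_cat_scheme \<Rightarrow> 'm \<Rightarrow> 'm" where
  "Neg C f = inv\<^bsub>hom_group C (Dom C f) (Cod C f)\<^esub> f"

definition zero_object :: "('o, 'm, 'x) cat_scheme \<Rightarrow> 'o \<Rightarrow> bool" where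
  "zero_object C N \<longleftrightarrow> N \<in> Ob C \<and>
     (\<forall>A \<in> Ob C. (\<exists>!f. f \<in> Hom C A N) \<and> (\<exists>!f. f \<in> Hom C N A))"

locale additive_category = category C
  for C :: "('o, 'm, 'x) add_cat_scheme" (structure) +
  assumes hom_comm_group: "\<lbrakk>A \<in> Ob C; B \<in> Ob C\<rbrakk> \<Longrightarrow> comm_group (hom_group C A B)"
    and Cmp_Add: "\<lbrakk>f \<in> Hom C A B; f' \<in> Hom C A B; g \<in> Hom C B B'\<rbrakk>
      \<Longrightarrow> g \<cdot> (f \<plusdot> f') = (g \<cdot> f) \<plusdot> (g \<cdot> f')"
    and Add_Cmp: "\<lbrakk>f \<in> Hom C A B; g \<in> Hom C B B'; g' \<in> Hom C B B'\<rbrakk>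
      \<Longrightarrow> (g \<plusdot> g') \<cdot> f = (g \<cdot> f) \<plusdot> (g' \<cdot> f)"
    and ex_zero_object: "\<exists>N. zero_object C N"
    and ex_biproduct: "\<lbrakk>A \<in> Ob C; B \<in> Ob C\<rbrakk> \<Longrightarrow>
      \<exists>P \<in> Ob C. \<exists>i \<in> Hom C A P. \<exists>j \<in> Hom C B P. \<exists>p \<in> Hom C P A. \<exists>q \<in> Hom C P B.
        p \<cdot> i = Idn C A \<and> q \<cdot> j = Idn C B \<and> p \<cdot> j = Zero C B A \<and> q \<cdot> i = Zero C A B \<and>
        (i \<cdot> p) \<plusdot> (j \<cdot> q) = Idn C P"

locale additive_functor = cat_functor S T F
  for S :: "('o, 'm, 'x) add_cat_scheme" and T :: "('p, 'n, 'y) add_cat_scheme"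
    and F :: "('o, 'm, 'p, 'n) func" +
  assumes far_Add: "\<lbrakk>f \<in> Hom S A B; g \<in> Hom S A B\<rbrakk>
    \<Longrightarrow> far F (f \<plusdot>\<^bsub>S\<^esub> g) = far F f \<plusdot>\<^bsub>T\<^esub> far F g"


section \<open>Triangulated categories\<close>

text \<open>
  The shift is an additive autoequivalence, \<open>Unshift\<close> being a chosen quasi-inverse
  \<open>?[-1]\<close>. The case of a strict automorphism is included.
  A triangle \<open>A \<rightarrow> B \<rightarrow> C \<rightarrow> A[1]\<close> is given by its three morphisms.
\<close>

record ('o, 'm) tri_cat = "('o, 'm) add_cat" +
  Shift :: "('o, 'm, 'o, 'm) func"
  Unshift :: "('o, 'm, 'o, 'm) func"
  Tri :: "('m \<times> 'm \<times> 'm) set"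

definition candidate_triangle :: "('o, 'm, 'x) tri_cat_scheme \<Rightarrow> 'm \<Rightarrow> 'm \<Rightarrow> 'm \<Rightarrow> bool" where
  "candidate_triangle D u v w \<longleftrightarrow> u \<in> Ar D \<and> v \<in> Ar D \<and> w \<in> Ar D \<and>
     Cod D u = Dom D v \<and> Cod D v = Dom D w \<and> Cod D w = fob (Shift D) (Dom D u)"

definition triangle_morphism ::
    "('o, 'm, 'x) tri_cat_scheme \<Rightarrow> 'm \<times> 'm \<times> 'm \<Rightarrow> 'm \<times> 'm \<times> 'm \<Rightarrow> 'm \<Rightarrow> 'm \<Rightarrow> 'm \<Rightarrow> bool" where
  "triangle_morphism D = (\<lambda>(u, v, w) (u', v', w') f g h.
     f \<in> Hom D (Dom D u) (Dom D u') \<and> g \<in> Hom D (Dom D v) (Dom D v') \<and>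
     h \<in> Hom D (Dom D w) (Dom D w') \<and>
     g \<cdot>\<^bsub>D\<^esub> u = u' \<cdot>\<^bsub>D\<^esub> f \<and> h \<cdot>\<^bsub>D\<^esub> v = v' \<cdot>\<^bsub>D\<^esub> g \<and>
     far (Shift D) f \<cdot>\<^bsub>D\<^esub> w = w' \<cdot>\<^bsub>D\<^esub> h)"

locale triangulated_category = additive_category D
  for D :: "('o, 'm, 'x) tri_cat_scheme" (structure) +
  assumes Shift_additive: "additive_functor D D (Shift D)"
    and Unshift_functor: "cat_functor D D (Unshift D)"
    and Unshift_Shift: "\<exists>\<phi>. nat_isomorphism D D id_func (comp_func (Unshift D) (Shift D)) \<phi>"
    and Shift_Unshift: "\<exists>\<psi>. nat_isomorphism D D (comp_func (Shift D) (Unshift D)) id_func \<psi>"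
    and Tri_candidate: "(u, v, w) \<in> Tri D \<Longrightarrow> candidate_triangle D u v w"
    and TR1_iso: "\<lbrakk>(u, v, w) \<in> Tri D; candidate_triangle D u' v' w';
        triangle_morphism D (u, v, w) (u', v', w') f g h;
        is_isomorphism D f; is_isomorphism D g; is_isomorphism D h\<rbrakk>
      \<Longrightarrow> (u', v', w') \<in> Tri D"
    and TR1_Idn: "\<lbrakk>A \<in> Ob D; zero_object D N\<rbrakk>
      \<Longrightarrow> (Idn D A, Zero D A N, Zero D N (fob (Shift D) A)) \<in> Tri D"
    and TR1_cone: "u \<in> Ar D \<Longrightarrow> \<exists>v w. (u, v, w) \<in> Tri D"
    and TR2: "candidate_triangle D u v w
      \<Longrightarrow> (u, v, w) \<in> Tri D \<longleftrightarrow> (v, w, Neg D (far (Shift D) u)) \<in> Tri D"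
    and TR3: "\<lbrakk>(u, v, w) \<in> Tri D; (u', v', w') \<in> Tri D;
        f \<in> Hom D (Dom D u) (Dom D u'); g \<in> Hom D (Cod D u) (Cod D u'); g \<cdot> u = u' \<cdot> f\<rbrakk>
      \<Longrightarrow> \<exists>h. triangle_morphism D (u, v, w) (u', v', w') f g h"
    and TR4: "\<lbrakk>Cod D u = Dom D v; (u, j, k) \<in> Tri D; (v, l, i) \<in> Tri D; (v \<cdot> u, m, n) \<in> Tri D\<rbrakk>
      \<Longrightarrow> \<exists>f g. (f, g, far (Shift D) j \<cdot> i) \<in> Tri D \<and>
            f \<in> Hom D (Cod D j) (Cod D m) \<and> g \<in> Hom D (Cod D m) (Cod D l) \<and>
            f \<cdot> j = m \<cdot> v \<and> n \<cdot> f = k \<and> g \<cdot> m = l \<and> i \<cdot> g = far (Shift D) u \<cdot> n"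


section \<open>t-structures and TTF triples\<close>

text \<open>The essential image \<open>V[1]\<close>, closed under isomorphisms since the shift is only an equivalence.\<close>

definition shifted :: "('o, 'm, 'x) tri_cat_scheme \<Rightarrow> 'o set \<Rightarrow> 'o set" where
  "shifted D V = {A \<in> Ob D. \<exists>B \<in> V. isomorphic D (fob (Shift D) B) A}"

text \<open>
  The t-structure is the pair \<open>(U, W)\<close> with \<open>W = V[1]\<close>; the orthogonality and the
  triangles refer to \<open>V\<close>.
\<close>

definition t_structure :: "('o, 'm, 'x) tri_cat_scheme \<Rightarrow> 'o set \<Rightarrow> 'o set \<Rightarrow> bool" where
  "t_structure D U W \<longleftrightarrow> (\<exists>V. W = shifted D V \<and>
     U \<subseteq> Ob D \<and> V \<subseteq> Ob D \<and> iso_closed D U \<and> iso_closed D V \<and>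
     (\<forall>A \<in> U. \<forall>B \<in> V. Hom D A B = {Zero D A B}) \<and>
     (\<forall>A \<in> U. fob (Shift D) A \<in> U) \<and>
     (\<forall>B \<in> V. fob (Unshift D) B \<in> V) \<and>
     (\<forall>M \<in> Ob D. \<exists>u v w. (u, v, w) \<in> Tri D \<and> Dom D u \<in> U \<and> Cod D u = M \<and> Cod D v \<in> V))"

definition triangulated_TTF_triple ::
    "('o, 'm, 'x) tri_cat_scheme \<Rightarrow> 'o set \<Rightarrow> 'o set \<Rightarrow> 'o set \<Rightarrow> bool" where
  "triangulated_TTF_triple D X Y Z \<longleftrightarrow> t_structure D X Y \<and> t_structure D Y Z"

text \<open>
  Meant for t-structures \<open>(U, V)\<close> with \<open>U\<close>, \<open>V\<close> triangulated, so that \<open>V[1] = V\<close>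
  and the truncation triangles of \<open>(U, V)\<close> have their third vertex in \<open>V\<close> itself.
  These triangles are unique up to isomorphism.
\<close>

definition t_structure_splits :: "('o, 'm, 'x) tri_cat_scheme \<Rightarrow> 'o set \<Rightarrow> 'o set \<Rightarrow> bool" where
  "t_structure_splits D U V \<longleftrightarrow> (\<forall>M \<in> Ob D. \<forall>u v w.
     (u, v, w) \<in> Tri D \<and> Dom D u \<in> U \<and> Cod D u = M \<and> Cod D v \<in> V \<longrightarrow> is_section D u)"

end

theory Submission
  imports Defs
begin

text \<open>
  Write \<open>A \<bottom> B\<close> when every morphism from an object of \<open>A\<close> to an object of \<open>B\<close> is zero. For a
  TTF triple, \<open>X \<bottom> Y\<close> and \<open>Y \<bottom> Z\<close>, each of the three classes is stable under the shift, and each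
  is determined by a neighbour: \<open>X\<close> is the left orthogonal of \<open>Y\<close> and \<open>Z\<close> the right orthogonal of
  \<open>Y\<close>. The point is that splitting is the reverse orthogonality: a pair \<open>(U, V)\<close> splits
  exactly when \<open>V \<bottom> U\<close> (\<open>splits_iff_orthogonal\<close>). A truncation triangle \<open>A \<rightarrow> M \<rightarrow> B \<rightarrow> A[1]\<close> splits
  exactly when its last map vanishes, and that map goes from \<open>V\<close> to \<open>U\<close>; conversely the cone of any
  \<open>f: B \<rightarrow> A\<close> gives a truncation triangle \<open>A \<rightarrow> M \<rightarrow> B[1] \<rightarrow> A[1]\<close> with last map \<open>-f[1]\<close>.

  Hence \<open>(X, Y)\<close> splits iff \<open>Y \<bottom> X\<close> iff \<open>X \<subseteq> Z\<close>, and \<open>(Y, Z)\<close> splits iff \<open>Z \<bottom> Y\<close> iff \<open>Z \<subseteq> X\<close>. Each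
  inclusion forces the other one. If \<open>(X, Y)\<close> splits and \<open>M\<close> lies in \<open>Z\<close>, the summand of \<open>M\<close> in \<open>Y\<close> is
  a subobject of \<open>M\<close>, hence zero, so \<open>M\<close> is in \<open>X\<close> (\<open>splits_imp_left_mem\<close>); dually
  for \<open>(Y, Z)\<close> (\<open>splits_imp_right_mem\<close>). So both splittings amount to \<open>X = Z\<close>.

  For the canonical map \<open>\<eta> \<delta>\<close>, the counit \<open>\<delta>\<close> is up to isomorphism the map \<open>A \<rightarrow> M\<close> of the truncation
  triangle for \<open>(Y, Z)\<close>, and the unit \<open>\<eta>\<close> is the map \<open>M \<rightarrow> B\<close> of the one for \<open>(X, Y)\<close>. If \<open>\<eta> \<delta>\<close> is a
  section, so is \<open>\<delta>\<close>, and \<open>(Y, Z)\<close> splits; if it is a retraction, so is \<open>\<eta>\<close>, and \<open>(X, Y)\<close> splits. If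
  \<open>X = Z\<close>, then \<open>M\<close> is the direct sum of an object of \<open>Y\<close> and an object of \<open>X\<close> with no nonzero maps
  between them in either direction, so \<open>\<delta>\<close> is the inclusion and \<open>\<eta>\<close> the projection of the summand in
  \<open>Y\<close>, and their composite is invertible (\<open>coreflection_reflection_iso\<close>).
\<close>

section \<open>Additive categories\<close>

context category
begin

lemma HomD: "f \<in> Hom C A B \<Longrightarrow> f \<in> Ar C \<and> Dom C f = A \<and> Cod C f = B \<and> A \<in> Ob C \<and> B \<in> Ob C"
  unfolding Hom_def using Dom_Ob Cod_Ob by auto

lemma is_isomorphism_iff:
  assumes "f \<in> Hom C A B"
  shows "is_isomorphism C f \<longleftrightarrow> (\<exists>g \<in> Hom C B A. g \<cdot> f = Idn C A \<and> f \<cdot> g = Idn C B)"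
  using HomD[OF assms] by (simp add: is_isomorphism_def)

lemma is_section_iff:
  assumes "f \<in> Hom C A B"
  shows "is_section C f \<longleftrightarrow> (\<exists>g \<in> Hom C B A. g \<cdot> f = Idn C A)"
  using HomD[OF assms] by (simp add: is_section_def)

lemma is_retraction_iff:
  assumes "f \<in> Hom C A B"
  shows "is_retraction C f \<longleftrightarrow> (\<exists>g \<in> Hom C B A. f \<cdot> g = Idn C B)"
  using HomD[OF assms] by (simp add: is_retraction_def)

lemma isomorphic_if_inverse:
  assumes "f \<in> Hom C A B" "g \<in> Hom C B A" "g \<cdot> f = Idn C A" "f \<cdot> g = Idn C B"
  shows "isomorphic C A B"
  using assms unfolding isomorphic_def by (metis is_isomorphism_iff)

lemma section_cancel:
  assumes "m \<in> Hom C B B'" "r \<in> Hom C B' B" "r \<cdot> m = Idn C B"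
    and "f \<in> Hom C A B" "g \<in> Hom C A B" "m \<cdot> f = m \<cdot> g"
  shows "f = g"
proof -
  have "f = r \<cdot> (m \<cdot> f)"
    using Cmp_assoc[OF assms(4,1,2)] assms(3) Idn_Cmp[OF assms(4)] by simp
  also have "\<dots> = g"
    using Cmp_assoc[OF assms(5,1,2)] assms(3,6) Idn_Cmp[OF assms(5)] by simp
  finally show ?thesis .
qed

lemma retraction_cancel:
  assumes "e \<in> Hom C A A'" "s \<in> Hom C A' A" "e \<cdot> s = Idn C A'"
    and "f \<in> Hom C A' B" "g \<in> Hom C A' B" "f \<cdot> e = g \<cdot> e"
  shows "f = g"
proof -
  have "f = (f \<cdot> e) \<cdot> s"
    using Cmp_assoc[OF assms(2,1,4)] assms(3) Cmp_Idn[OF assms(4)] by simp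
  also have "\<dots> = g"
    using Cmp_assoc[OF assms(2,1,5)] assms(3,6) Cmp_Idn[OF assms(5)] by simp
  finally show ?thesis .
qed

lemma is_isomorphism_imp_section: "is_isomorphism C f \<Longrightarrow> is_section C f"
  and is_isomorphism_imp_retraction: "is_isomorphism C f \<Longrightarrow> is_retraction C f"
  unfolding is_isomorphism_def is_section_def is_retraction_def by blast+

lemma section_of_comp:
  assumes f: "f \<in> Hom C A B" and g: "g \<in> Hom C B B'" and s: "is_section C (g \<cdot> f)"
  shows "is_section C f"
proof -
  obtain r where r: "r \<in> Hom C B' A" "r \<cdot> (g \<cdot> f) = Idn C A"
    using s is_section_iff[OF Cmp_Hom[OF f g]] by blast
  then have "(r \<cdot> g) \<cdot> f = Idn C A"
    using Cmp_assoc[OF f g r(1)] by simp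
  then show ?thesis
    using is_section_iff[OF f] Cmp_Hom[OF g r(1)] by blast
qed

lemma retraction_of_comp:
  assumes f: "f \<in> Hom C A B" and g: "g \<in> Hom C B B'" and s: "is_retraction C (g \<cdot> f)"
  shows "is_retraction C g"
proof -
  obtain r where r: "r \<in> Hom C B' A" "(g \<cdot> f) \<cdot> r = Idn C B'"
    using s is_retraction_iff[OF Cmp_Hom[OF f g]] by blast
  then have "g \<cdot> (f \<cdot> r) = Idn C B'"
    using Cmp_assoc[OF r(1) f g] by simp
  then show ?thesis
    using is_retraction_iff[OF g] Cmp_Hom[OF r(1) f] by blast
qed

end

context additive_category
begin

lemma Zero_Hom: "\<lbrakk>A \<in> Ob C; B \<in> Ob C\<rbrakk> \<Longrightarrow> Zero C A B \<in> Hom C A B"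
  using monoid.one_closed[OF group.is_monoid[OF comm_group.axioms(2)[OF hom_comm_group]]]
  by (simp add: hom_group_def)

lemma Add_Hom: "\<lbrakk>f \<in> Hom C A B; g \<in> Hom C A B\<rbrakk> \<Longrightarrow> f \<plusdot> g \<in> Hom C A B"
  using monoid.m_closed[OF group.is_monoid[OF comm_group.axioms(2)[OF hom_comm_group]], of A B f g]
  by (simp add: hom_group_def HomD)

lemma Zero_Add: "f \<in> Hom C A B \<Longrightarrow> Zero C A B \<plusdot> f = f"
  using monoid.l_one[OF group.is_monoid[OF comm_group.axioms(2)[OF hom_comm_group]], of A B f]
  by (simp add: hom_group_def HomD)

lemma Add_right_cancel:
  "\<lbrakk>f \<in> Hom C A B; g \<in> Hom C A B; h \<in> Hom C A B\<rbrakk> \<Longrightarrow> f \<plusdot> h = g \<plusdot> h \<longleftrightarrow> f = g"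
  using group.right_cancel[OF comm_group.axioms(2)[OF hom_comm_group], of A B h f g]
  by (simp add: hom_group_def HomD)

lemma Neg_Hom: "f \<in> Hom C A B \<Longrightarrow> Neg C f \<in> Hom C A B"
  using group.inv_closed[OF comm_group.axioms(2)[OF hom_comm_group], of A B f]
  by (simp add: hom_group_def Neg_def HomD)

lemma Neg_Add: "f \<in> Hom C A B \<Longrightarrow> Neg C f \<plusdot> f = Zero C A B"
  using group.l_inv[OF comm_group.axioms(2)[OF hom_comm_group], of A B f]
  by (simp add: hom_group_def Neg_def HomD)

lemma Add_Neg: "f \<in> Hom C A B \<Longrightarrow> f \<plusdot> Neg C f = Zero C A B"
  using group.r_inv[OF comm_group.axioms(2)[OF hom_comm_group], of A B f]
  by (simp add: hom_group_def Neg_def HomD)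

lemma Neg_Neg: "f \<in> Hom C A B \<Longrightarrow> Neg C (Neg C f) = f"
  using Add_right_cancel[of "Neg C (Neg C f)" A B f "Neg C f"]
  by (simp add: Neg_Hom Neg_Add Add_Neg)

lemma Add_idem_Zero:
  assumes "f \<in> Hom C A B" "f \<plusdot> f = f"
  shows "f = Zero C A B"
  using Add_right_cancel[OF assms(1) Zero_Hom assms(1)] assms Zero_Add HomD by simp

lemma Cmp_Zero:
  assumes "g \<in> Hom C B B'" "A \<in> Ob C"
  shows "g \<cdot> Zero C A B = Zero C A B'"
proof -
  have z: "Zero C A B \<in> Hom C A B"
    using assms HomD Zero_Hom by blast
  then have "g \<cdot> Zero C A B \<plusdot> g \<cdot> Zero C A B = g \<cdot> Zero C A B"
    using Cmp_Add[OF z z assms(1)] Zero_Add by simp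
  then show ?thesis
    using Add_idem_Zero Cmp_Hom[OF z assms(1)] by blast
qed

lemma Zero_Cmp:
  assumes "f \<in> Hom C A B" "B' \<in> Ob C"
  shows "Zero C B B' \<cdot> f = Zero C A B'"
proof -
  have z: "Zero C B B' \<in> Hom C B B'"
    using assms HomD Zero_Hom by blast
  then have "Zero C B B' \<cdot> f \<plusdot> Zero C B B' \<cdot> f = Zero C B B' \<cdot> f"
    using Add_Cmp[OF assms(1) z z] Zero_Add by simp
  then show ?thesis
    using Add_idem_Zero Cmp_Hom[OF assms(1) z] by blast
qed

lemma Neg_Cmp:
  assumes "f \<in> Hom C A B" "g \<in> Hom C B B'"
  shows "Neg C g \<cdot> f = Neg C (g \<cdot> f)"
proof -
  have "Neg C g \<cdot> f \<plusdot> g \<cdot> f = Zero C A B'"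
    using Add_Cmp[OF assms(1) Neg_Hom[OF assms(2)] assms(2)] Neg_Add[OF assms(2)]
      Zero_Cmp[OF assms(1)] HomD[OF assms(2)] by simp
  then show ?thesis
    using Add_right_cancel[OF Cmp_Hom[OF assms(1) Neg_Hom[OF assms(2)]] Neg_Hom[OF Cmp_Hom[OF assms]] Cmp_Hom[OF assms]]
      Neg_Add[OF Cmp_Hom[OF assms]] by simp
qed

lemma Cmp_Neg:
  assumes "f \<in> Hom C A B" "g \<in> Hom C B B'"
  shows "g \<cdot> Neg C f = Neg C (g \<cdot> f)"
proof -
  have "g \<cdot> Neg C f \<plusdot> g \<cdot> f = Zero C A B'"
    using Cmp_Add[OF Neg_Hom[OF assms(1)] assms(1) assms(2)] Neg_Add[OF assms(1)]
      Cmp_Zero[OF assms(2)] HomD[OF assms(1)] by simp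
  then show ?thesis
    using Add_right_cancel[OF Cmp_Hom[OF Neg_Hom[OF assms(1)] assms(2)] Neg_Hom[OF Cmp_Hom[OF assms]] Cmp_Hom[OF assms]]
      Neg_Add[OF Cmp_Hom[OF assms]] by simp
qed

lemma Neg_Zero: "\<lbrakk>A \<in> Ob C; B \<in> Ob C\<rbrakk> \<Longrightarrow> Neg C (Zero C A B) = Zero C A B"
  using Add_Neg[OF Zero_Hom] Zero_Add[OF Neg_Hom[OF Zero_Hom]] by simp

lemma Neg_eq_Zero_iff: "f \<in> Hom C A B \<Longrightarrow> Neg C f = Zero C A B \<longleftrightarrow> f = Zero C A B"
  using Neg_Neg[of f A B] Neg_Zero[of A B] HomD[of f A B] by auto

text \<open>
  This and its dual let cancellation of a single morphism be checked on zero composites only, which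
  is the form that exactness of triangles delivers.
\<close>

lemma Cmp_cancel_if_kernel_trivial:
  assumes fg: "f \<in> Hom C A B" "f' \<in> Hom C A B" and g: "g \<in> Hom C B B'" and eq: "g \<cdot> f = g \<cdot> f'"
    and ker: "\<And>k. \<lbrakk>k \<in> Hom C A B; g \<cdot> k = Zero C A B'\<rbrakk> \<Longrightarrow> k = Zero C A B"
  shows "f = f'"
proof -
  have "g \<cdot> (f \<plusdot> Neg C f') = Zero C A B'"
    using Cmp_Add[OF fg(1) Neg_Hom[OF fg(2)] g] Cmp_Neg[OF fg(2) g] eq
      Add_Neg[OF Cmp_Hom[OF fg(2) g]] by simp
  then have "f \<plusdot> Neg C f' = Zero C A B"
    using ker Add_Hom[OF fg(1) Neg_Hom[OF fg(2)]] by blast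
  then show ?thesis
    using Add_right_cancel[OF fg Neg_Hom[OF fg(2)]] Add_Neg[OF fg(2)] by simp
qed

lemma Cmp_cancel_if_cokernel_trivial:
  assumes fg: "f \<in> Hom C B B'" "f' \<in> Hom C B B'" and g: "g \<in> Hom C A B" and eq: "f \<cdot> g = f' \<cdot> g"
    and coker: "\<And>k. \<lbrakk>k \<in> Hom C B B'; k \<cdot> g = Zero C A B'\<rbrakk> \<Longrightarrow> k = Zero C B B'"
  shows "f = f'"
proof -
  have "(f \<plusdot> Neg C f') \<cdot> g = Zero C A B'"
    using Add_Cmp[OF g fg(1) Neg_Hom[OF fg(2)]] Neg_Cmp[OF g fg(2)] eq
      Add_Neg[OF Cmp_Hom[OF g fg(2)]] by simp
  then have "f \<plusdot> Neg C f' = Zero C B B'"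
    using coker Add_Hom[OF fg(1) Neg_Hom[OF fg(2)]] by blast
  then show ?thesis
    using Add_right_cancel[OF fg Neg_Hom[OF fg(2)]] Add_Neg[OF fg(2)] by simp
qed

lemma zero_object_Hom:
  assumes "zero_object C N"
  shows "f \<in> Hom C A N \<Longrightarrow> f = Zero C A N" and "f \<in> Hom C N A \<Longrightarrow> f = Zero C N A"
proof -
  have N: "N \<in> Ob C"
    using assms unfolding zero_object_def by blast
  show "f = Zero C A N" if "f \<in> Hom C A N"
  proof -
    have A: "A \<in> Ob C"
      using HomD[OF that] by blast
    then have "\<exists>!f. f \<in> Hom C A N"
      using assms unfolding zero_object_def by blast
    then show ?thesis
      using that Zero_Hom[OF A N] by blast
  qed
  show "f = Zero C N A" if "f \<in> Hom C N A"
  proof -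
    have A: "A \<in> Ob C"
      using HomD[OF that] by blast
    then have "\<exists>!f. f \<in> Hom C N A"
      using assms unfolding zero_object_def by blast
    then show ?thesis
      using that Zero_Hom[OF N A] by blast
  qed
qed

lemma zero_object_iff:
  assumes "N \<in> Ob C"
  shows "zero_object C N \<longleftrightarrow> Idn C N = Zero C N N"
proof
  assume "zero_object C N"
  then show "Idn C N = Zero C N N"
    using zero_object_Hom Idn_Hom assms by blast
next
  assume i: "Idn C N = Zero C N N"
  have "f = Zero C A N" if "f \<in> Hom C A N" for A f
    using Idn_Cmp[OF that] Zero_Cmp[OF that assms] i by simp
  moreover have "f = Zero C N A" if "f \<in> Hom C N A" for A f
    using Cmp_Idn[OF that] Cmp_Zero[OF that assms] i by simp
  ultimately show "zero_object C N"
    unfolding zero_object_def using Zero_Hom assms by blast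
qed

end

section \<open>Exactness in triangulated categories\<close>

context triangulated_category
begin

abbreviation shift_ob :: "'o \<Rightarrow> 'o" where "shift_ob \<equiv> fob (Shift D)"
abbreviation shift_ar :: "'m \<Rightarrow> 'm" where "shift_ar \<equiv> far (Shift D)"

lemma shift_Ob: "A \<in> Ob D \<Longrightarrow> shift_ob A \<in> Ob D"
  and shift_Hom: "f \<in> Hom D A B \<Longrightarrow> shift_ar f \<in> Hom D (shift_ob A) (shift_ob B)"
  and shift_Idn: "A \<in> Ob D \<Longrightarrow> shift_ar (Idn D A) = Idn D (shift_ob A)"
  and shift_Cmp: "\<lbrakk>f \<in> Hom D A B; g \<in> Hom D B B'\<rbrakk> \<Longrightarrow> shift_ar (g \<cdot> f) = shift_ar g \<cdot> shift_ar f"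
  using Shift_additive unfolding additive_functor_def cat_functor_def cat_functor_axioms_def
  by blast+

lemma shift_Zero:
  assumes "A \<in> Ob D" "B \<in> Ob D"
  shows "shift_ar (Zero D A B) = Zero D (shift_ob A) (shift_ob B)"
proof -
  have z: "Zero D A B \<in> Hom D A B"
    using Zero_Hom assms .
  have "shift_ar (Zero D A B) \<plusdot> shift_ar (Zero D A B) = shift_ar (Zero D A B)"
    using additive_functor.far_Add[OF Shift_additive z z] Zero_Add[OF z] by simp
  then show ?thesis
    using Add_idem_Zero shift_Hom[OF z] by blast
qed

lemma shift_faithful:
  assumes f: "f \<in> Hom D A B" and g: "g \<in> Hom D A B" and eq: "shift_ar f = shift_ar g"
  shows "f = g"
proof -
  obtain \<phi> where "nat_isomorphism D D id_func (comp_func (Unshift D) (Shift D)) \<phi>"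
    using Unshift_Shift by blast
  then interpret \<phi>: nat_isomorphism D D id_func "comp_func (Unshift D) (Shift D)" \<phi> .
  have B: "B \<in> Ob D"
    using HomD[OF f] by blast
  have \<phi>B: "\<phi> B \<in> Hom D B (fob (Unshift D) (shift_ob B))"
    using \<phi>.component_Hom[OF B] by (simp add: id_func_def comp_func_def)
  have "\<phi> B \<cdot> f = \<phi> B \<cdot> g"
    using \<phi>.naturality[OF f] \<phi>.naturality[OF g] eq by (simp add: id_func_def comp_func_def)
  moreover obtain r where "r \<in> Hom D (fob (Unshift D) (shift_ob B)) B" "r \<cdot> \<phi> B = Idn D B"
    using \<phi>.component_iso[OF B] \<phi>B is_isomorphism_iff by blast
  ultimately show ?thesis
    using section_cancel[OF \<phi>B] f g by blast
qed

text \<open>Proved separately because fullness of the shift reduces to faithfulness of its quasi-inverse.\<close>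

lemma unshift_faithful:
  assumes f: "f \<in> Hom D A B" and g: "g \<in> Hom D A B"
    and eq: "far (Unshift D) f = far (Unshift D) g"
  shows "f = g"
proof -
  obtain \<psi> where "nat_isomorphism D D (comp_func (Shift D) (Unshift D)) id_func \<psi>"
    using Shift_Unshift by blast
  then interpret \<psi>: nat_isomorphism D D "comp_func (Shift D) (Unshift D)" id_func \<psi> .
  have A: "A \<in> Ob D"
    using HomD[OF f] by blast
  have \<psi>A: "\<psi> A \<in> Hom D (shift_ob (fob (Unshift D) A)) A"
    using \<psi>.component_Hom[OF A] by (simp add: id_func_def comp_func_def)
  have "f \<cdot> \<psi> A = g \<cdot> \<psi> A"
    using \<psi>.naturality[OF f] \<psi>.naturality[OF g] eq by (simp add: id_func_def comp_func_def)
  moreover obtain s where "s \<in> Hom D A (shift_ob (fob (Unshift D) A))" "\<psi> A \<cdot> s = Idn D A"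
    using \<psi>.component_iso[OF A] \<psi>A is_isomorphism_iff by blast
  ultimately show ?thesis
    using retraction_cancel[OF \<psi>A] f g by blast
qed

text \<open>
  The preimage of \<open>h\<close> is \<open>h[-1]\<close> conjugated by the isomorphisms \<open>A \<cong> A[1][-1]\<close>; it is
  compared with \<open>h\<close> after applying the faithful functor \<open>?[-1]\<close>.
\<close>

lemma shift_full:
  assumes A: "A \<in> Ob D" and B: "B \<in> Ob D" and h: "h \<in> Hom D (shift_ob A) (shift_ob B)"
  obtains f where "f \<in> Hom D A B" "shift_ar f = h"
proof -
  let ?U = "Unshift D"
  interpret U: cat_functor D D ?U
    by (rule Unshift_functor)
  obtain \<phi> where "nat_isomorphism D D id_func (comp_func ?U (Shift D)) \<phi>"
    using Unshift_Shift by blast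
  then interpret \<phi>: nat_isomorphism D D id_func "comp_func ?U (Shift D)" \<phi> .
  have \<phi>A: "\<phi> A \<in> Hom D A (fob ?U (shift_ob A))" and \<phi>B: "\<phi> B \<in> Hom D B (fob ?U (shift_ob B))"
    using \<phi>.component_Hom A B by (simp_all add: id_func_def comp_func_def)
  obtain s where s: "s \<in> Hom D (fob ?U (shift_ob A)) A" "\<phi> A \<cdot> s = Idn D (fob ?U (shift_ob A))"
    using \<phi>.component_iso[OF A] \<phi>A is_isomorphism_iff by blast
  obtain r where r: "r \<in> Hom D (fob ?U (shift_ob B)) B" "\<phi> B \<cdot> r = Idn D (fob ?U (shift_ob B))"
    using \<phi>.component_iso[OF B] \<phi>B is_isomorphism_iff by blast
  have Uh: "far ?U h \<in> Hom D (fob ?U (shift_ob A)) (fob ?U (shift_ob B))"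
    using U.far_Hom h .
  have Uh\<phi>: "far ?U h \<cdot> \<phi> A \<in> Hom D A (fob ?U (shift_ob B))"
    using Cmp_Hom \<phi>A Uh .
  define f where "f = r \<cdot> (far ?U h \<cdot> \<phi> A)"
  have f: "f \<in> Hom D A B"
    unfolding f_def using Cmp_Hom[OF Uh\<phi> r(1)] .
  have "far ?U (shift_ar f) \<cdot> \<phi> A = \<phi> B \<cdot> f"
    using \<phi>.naturality[OF f] by (simp add: id_func_def comp_func_def)
  also have "\<dots> = far ?U h \<cdot> \<phi> A"
    unfolding f_def using Cmp_assoc[OF Uh\<phi> r(1) \<phi>B] r(2) Idn_Cmp[OF Uh\<phi>] by simp
  finally have "far ?U (shift_ar f) = far ?U h"
    using retraction_cancel[OF \<phi>A s U.far_Hom[OF shift_Hom[OF f]] Uh] by blast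
  then have "shift_ar f = h"
    using unshift_faithful shift_Hom[OF f] h by blast
  then show ?thesis
    using that f by blast
qed

lemma shift_eq_Zero_iff:
  assumes "f \<in> Hom D A B"
  shows "shift_ar f = Zero D (shift_ob A) (shift_ob B) \<longleftrightarrow> f = Zero D A B"
  using HomD[OF assms] shift_Zero[of A B] shift_faithful[OF assms Zero_Hom] by metis

definition tri :: "'o \<Rightarrow> 'o \<Rightarrow> 'o \<Rightarrow> 'm \<Rightarrow> 'm \<Rightarrow> 'm \<Rightarrow> bool" where
  "tri A B E u v w \<longleftrightarrow> (u, v, w) \<in> Tri D \<and>
     u \<in> Hom D A B \<and> v \<in> Hom D B E \<and> w \<in> Hom D E (shift_ob A)"

lemma tri_Hom:
  assumes "tri A B E u v w"
  shows "u \<in> Hom D A B" "v \<in> Hom D B E" "w \<in> Hom D E (shift_ob A)"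
  using assms unfolding tri_def by blast+

lemma tri_Ob:
  assumes "tri A B E u v w"
  shows "A \<in> Ob D" "B \<in> Ob D" "E \<in> Ob D"
  using tri_Hom[OF assms] HomD by blast+

lemma Tri_tri:
  assumes "(u, v, w) \<in> Tri D"
  shows "tri (Dom D u) (Cod D u) (Cod D v) u v w"
  using Tri_candidate[OF assms] assms unfolding tri_def candidate_triangle_def Hom_def by simp

lemma tri_rotate:
  assumes "tri A B E u v w"
  shows "tri B E (shift_ob A) v w (Neg D (shift_ar u))"
proof -
  have "candidate_triangle D u v w"
    using Tri_candidate assms unfolding tri_def by blast
  then show ?thesis
    using assms TR2 Neg_Hom shift_Hom unfolding tri_def by blast
qed

lemma tri_morphism:
  assumes t: "tri A B E u v w" and t': "tri A' B' E' u' v' w'"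
    and f: "f \<in> Hom D A A'" and g: "g \<in> Hom D B B'" and eq: "g \<cdot> u = u' \<cdot> f"
  obtains h where "h \<in> Hom D E E'" "h \<cdot> v = v' \<cdot> g" "shift_ar f \<cdot> w = w' \<cdot> h"
proof -
  note d = tri_Hom[OF t, THEN HomD] tri_Hom[OF t', THEN HomD]
  have "\<exists>h. triangle_morphism D (u, v, w) (u', v', w') f g h"
    using TR3[of u v w u' v' w' f g] t t' f g eq d unfolding tri_def by simp
  then show ?thesis
    using that d unfolding triangle_morphism_def by auto
qed

lemma tri_Idn:
  assumes "A \<in> Ob D" "zero_object D N"
  shows "tri A A N (Idn D A) (Zero D A N) (Zero D N (shift_ob A))"
  using assms TR1_Idn Idn_Hom Zero_Hom shift_Ob unfolding tri_def zero_object_def by simp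

lemma zero_object_shift:
  assumes "zero_object D N"
  shows "zero_object D (shift_ob N)"
proof -
  have N: "N \<in> Ob D"
    using assms unfolding zero_object_def by blast
  then show ?thesis
    using assms zero_object_iff[OF N] zero_object_iff[OF shift_Ob[OF N]] shift_Idn[OF N]
      shift_Zero[OF N N] by simp
qed

text \<open>
  Rotating this triangle once gives the identity triangle on \<open>B\<close> with third vertex \<open>N[1]\<close>, which is
  again a zero object.
\<close>

lemma tri_Idn_rotated:
  assumes B: "B \<in> Ob D" and N: "zero_object D N"
  shows "tri N B B (Zero D N B) (Idn D B) (Zero D B (shift_ob N))"
proof -
  have NO: "N \<in> Ob D"
    using N unfolding zero_object_def by blast
  note homs = Zero_Hom[OF NO B] Idn_Hom[OF B] Zero_Hom[OF B shift_Ob[OF NO]]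
  have "candidate_triangle D (Zero D N B) (Idn D B) (Zero D B (shift_ob N))"
    using homs[THEN HomD] unfolding candidate_triangle_def by simp
  moreover have "Neg D (shift_ar (Zero D N B)) = Zero D (shift_ob N) (shift_ob B)"
    using shift_Zero[OF NO B] Neg_Zero shift_Ob NO B by simp
  ultimately show ?thesis
    using TR2 TR1_Idn[OF B zero_object_shift[OF N]] homs unfolding tri_def by metis
qed

text \<open>
  The identity triangle of \<open>A\<close> maps to the given one by the identity and \<open>u\<close>, so \<open>v u\<close> factors
  through a zero object.
\<close>

lemma tri_comp_Zero:
  assumes t: "tri A B E u v w"
  shows "v \<cdot> u = Zero D A E"
proof -
  obtain N where N: "zero_object D N"
    using ex_zero_object by blast
  note O = tri_Ob[OF t] and H = tri_Hom[OF t]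
  obtain h where h: "h \<in> Hom D N E" "h \<cdot> Zero D A N = v \<cdot> u"
    using tri_morphism[OF tri_Idn[OF O(1) N] t Idn_Hom[OF O(1)] H(1)] by blast
  then show ?thesis
    using Cmp_Zero O by metis
qed

text \<open>
  The square formed by \<open>f\<close> and the zero objects extends to a morphism from the rotated identity
  triangle of \<open>M\<close> to the rotated given triangle. Its third component is a map \<open>M[1] \<rightarrow> A[1]\<close>, so full
  faithfulness of the shift is needed to bring the factorization back to \<open>M \<rightarrow> A\<close>.
\<close>

lemma tri_exact:
  assumes t: "tri A B E u v w" and f: "f \<in> Hom D M B" and z: "v \<cdot> f = Zero D M E"
  obtains g where "g \<in> Hom D M A" "u \<cdot> g = f"
proof -
  obtain N where N: "zero_object D N"
    using ex_zero_object by blast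
  note O = tri_Ob[OF t] and H = tri_Hom[OF t]
  have M: "M \<in> Ob D" and NO: "N \<in> Ob D"
    using f HomD N unfolding zero_object_def by blast+
  have "Zero D N E \<cdot> Zero D M N = v \<cdot> f"
    using z Cmp_Zero[OF Zero_Hom[OF NO O(3)] M] by simp
  then obtain h where h: "h \<in> Hom D (shift_ob M) (shift_ob A)"
    and eq: "shift_ar f \<cdot> Neg D (shift_ar (Idn D M)) = Neg D (shift_ar u) \<cdot> h"
    using tri_morphism[OF tri_rotate[OF tri_Idn[OF M N]] tri_rotate[OF t] f Zero_Hom[OF NO O(3)]]
    by blast
  obtain g where g: "g \<in> Hom D M A" "shift_ar g = h"
    using shift_full M O(1) h by blast
  note Su = shift_Hom[OF H(1)] and Sf = shift_Hom[OF f]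
  have "Neg D (shift_ar f) = Neg D (shift_ar u \<cdot> h)"
    using eq Neg_Cmp[OF h Su] Cmp_Neg[OF Idn_Hom[OF shift_Ob[OF M]] Sf] Cmp_Idn[OF Sf]
      shift_Idn[OF M] by simp
  from arg_cong[OF this, of "Neg D"] have "shift_ar f = shift_ar u \<cdot> h"
    unfolding Neg_Neg[OF Sf] Neg_Neg[OF Cmp_Hom[OF h Su]] .
  then have "shift_ar (u \<cdot> g) = shift_ar f"
    using shift_Cmp[OF g(1) H(1)] g(2) by simp
  then have "u \<cdot> g = f"
    using shift_faithful Cmp_Hom[OF g(1) H(1)] f by blast
  then show ?thesis
    using that g(1) by blast
qed

text \<open>
  The morphism of triangles ends in \<open>N \<rightarrow> M \<rightarrow> M \<rightarrow> N[1]\<close> with \<open>N\<close> zero, whose middle map is the identity;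
  so its third component is the factorization itself.
\<close>

lemma tri_coexact:
  assumes t: "tri A B E u v w" and f: "f \<in> Hom D B M" and z: "f \<cdot> u = Zero D A M"
  obtains g where "g \<in> Hom D E M" "g \<cdot> v = f"
proof -
  obtain N where N: "zero_object D N"
    using ex_zero_object by blast
  note O = tri_Ob[OF t]
  have M: "M \<in> Ob D" and NO: "N \<in> Ob D"
    using f HomD N unfolding zero_object_def by blast+
  have "f \<cdot> u = Zero D N M \<cdot> Zero D A N"
    using z Cmp_Zero[OF Zero_Hom[OF NO M] O(1)] by simp
  then obtain h where "h \<in> Hom D E M" "h \<cdot> v = Idn D M \<cdot> f"
    using tri_morphism[OF t tri_Idn_rotated[OF M N] Zero_Hom[OF O(1) NO] f] by blast
  then show ?thesis
    using that Idn_Cmp[OF f] by simp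
qed

text \<open>
  Exactness at \<open>A\<close>, phrased after one shift so that the object \<open>E[-1]\<close> does not
  have to be formed.
\<close>

lemma tri_shift_kernel:
  assumes t: "tri A B E u v w" and f: "f \<in> Hom D M A" and z: "u \<cdot> f = Zero D M B"
  obtains h where "h \<in> Hom D (shift_ob M) E" "w \<cdot> h = shift_ar f"
proof -
  note O = tri_Ob[OF t] and H = tri_Hom[OF t]
  have M: "M \<in> Ob D"
    using HomD[OF f] by blast
  have "Neg D (shift_ar u) \<cdot> shift_ar f = Neg D (shift_ar (u \<cdot> f))"
    using Neg_Cmp[OF shift_Hom[OF f] shift_Hom[OF H(1)]] shift_Cmp[OF f H(1)] by simp
  also have "\<dots> = Zero D (shift_ob M) (shift_ob B)"
    using z shift_Zero[OF M O(2)] Neg_Zero[OF shift_Ob[OF M] shift_Ob[OF O(2)]] by simp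
  finally show ?thesis
    using tri_exact[OF tri_rotate[OF tri_rotate[OF t]] shift_Hom[OF f]] that by blast
qed

text \<open>
  The composite \<open>u[1] w\<close> is zero, so a left inverse of \<open>u\<close> kills \<open>w\<close>. If \<open>w\<close> is zero, the identity of
  \<open>A[1]\<close> composes with \<open>w\<close> to zero and so factors through \<open>-u[1]\<close>.
\<close>

lemma tri_section_iff:
  assumes t: "tri A B E u v w"
  shows "is_section D u \<longleftrightarrow> w = Zero D E (shift_ob A)"
proof
  note O = tri_Ob[OF t] and H = tri_Hom[OF t]
  note Su = shift_Hom[OF H(1)]
  assume "is_section D u"
  then obtain r where r: "r \<in> Hom D B A" "r \<cdot> u = Idn D A"
    using is_section_iff H(1) by blast
  have "Neg D (shift_ar u \<cdot> w) = Zero D E (shift_ob B)"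
    using tri_comp_Zero[OF tri_rotate[OF tri_rotate[OF t]]] Neg_Cmp[OF H(3) Su] by simp
  then have uw: "shift_ar u \<cdot> w = Zero D E (shift_ob B)"
    using Neg_eq_Zero_iff Cmp_Hom[OF H(3) Su] by blast
  have "w = shift_ar (r \<cdot> u) \<cdot> w"
    using r(2) shift_Idn[OF O(1)] Idn_Cmp[OF H(3)] by simp
  also have "\<dots> = shift_ar r \<cdot> (shift_ar u \<cdot> w)"
    using shift_Cmp[OF H(1) r(1)] Cmp_assoc[OF H(3) Su shift_Hom[OF r(1)]] by simp
  also have "\<dots> = Zero D E (shift_ob A)"
    using uw Cmp_Zero[OF shift_Hom[OF r(1)] O(3)] by simp
  finally show "w = Zero D E (shift_ob A)" .
next
  note O = tri_Ob[OF t] and H = tri_Hom[OF t]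
  note SA = shift_Ob[OF O(1)] and Su = shift_Hom[OF H(1)]
  assume "w = Zero D E (shift_ob A)"
  then have "Idn D (shift_ob A) \<cdot> w = Zero D E (shift_ob A)"
    using Idn_Cmp[OF H(3)] by simp
  then obtain g where g: "g \<in> Hom D (shift_ob B) (shift_ob A)"
      "g \<cdot> Neg D (shift_ar u) = Idn D (shift_ob A)"
    using tri_coexact[OF tri_rotate[OF tri_rotate[OF t]] Idn_Hom[OF SA]] by blast
  obtain r where r: "r \<in> Hom D B A" "shift_ar r = Neg D g"
    using shift_full O Neg_Hom[OF g(1)] by blast
  have "shift_ar (r \<cdot> u) = shift_ar (Idn D A)"
    using shift_Cmp[OF H(1) r(1)] r(2) g(2) Neg_Cmp[OF Su g(1)] Cmp_Neg[OF Su g(1)]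
      shift_Idn[OF O(1)] by simp
  then have "r \<cdot> u = Idn D A"
    using shift_faithful Cmp_Hom[OF H(1) r(1)] Idn_Hom[OF O(1)] by blast
  then show "is_section D u"
    using is_section_iff H(1) r(1) by blast
qed

lemma tri_retraction_iff:
  assumes t: "tri A B E u v w"
  shows "is_retraction D v \<longleftrightarrow> w = Zero D E (shift_ob A)"
proof
  note O = tri_Ob[OF t] and H = tri_Hom[OF t]
  assume "is_retraction D v"
  then obtain s where s: "s \<in> Hom D E B" "v \<cdot> s = Idn D E"
    using is_retraction_iff H(2) by blast
  then have "w = (w \<cdot> v) \<cdot> s"
    using Cmp_assoc[OF s(1) H(2,3)] Cmp_Idn[OF H(3)] by simp
  then show "w = Zero D E (shift_ob A)"
    using tri_comp_Zero[OF tri_rotate[OF t]] Zero_Cmp[OF s(1) shift_Ob[OF O(1)]] by simp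
next
  note O = tri_Ob[OF t] and H = tri_Hom[OF t]
  assume "w = Zero D E (shift_ob A)"
  then have "w \<cdot> Idn D E = Zero D E (shift_ob A)"
    using Cmp_Idn[OF H(3)] by simp
  then obtain s where "s \<in> Hom D E B" "v \<cdot> s = Idn D E"
    using tri_exact[OF tri_rotate[OF t] Idn_Hom[OF O(3)]] by blast
  then show "is_retraction D v"
    using is_retraction_iff H(2) by blast
qed

end

section \<open>t-structures with triangulated aisle and coaisle\<close>

definition orthogonal :: "('o, 'm, 'x) add_cat_scheme \<Rightarrow> 'o set \<Rightarrow> 'o set \<Rightarrow> bool" where
  "orthogonal C U V \<longleftrightarrow> (\<forall>A \<in> U. \<forall>B \<in> V. \<forall>f \<in> Hom C A B. f = Zero C A B)"

text \<open>
  A general t-structure \<open>(U, V[1])\<close>. For the pair \<open>(Y, Z)\<close> of a TTF triple the shift-closure of the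
  right-hand class is a consequence of the orthogonality statements below.
\<close>

locale aisle_pair = triangulated_category D
  for D :: "('o, 'm, 'x) tri_cat_scheme" (structure) and U V :: "'o set" +
  assumes U_Ob: "U \<subseteq> Ob D" and V_Ob: "V \<subseteq> Ob D"
    and U_iso: "iso_closed D U" and V_iso: "iso_closed D V"
    and U_shift: "A \<in> U \<Longrightarrow> shift_ob A \<in> U"
    and orth: "orthogonal D U V"
    and truncation: "M \<in> Ob D \<Longrightarrow> \<exists>A \<in> U. \<exists>B \<in> V. \<exists>u v w. tri A M B u v w"
begin

lemma orthD: "\<lbrakk>f \<in> Hom D A B; A \<in> U; B \<in> V\<rbrakk> \<Longrightarrow> f = Zero D A B"
  using orth unfolding orthogonal_def by blast

text \<open>
  A map \<open>k: K \<rightarrow> A\<close> killed by \<open>u\<close> has \<open>k[1]\<close> factoring through \<open>K[1] \<rightarrow> B\<close>, which is zero since \<open>K[1]\<close>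
  stays in \<open>U\<close>. So \<open>u\<close> is a coreflection of \<open>M\<close> into \<open>U\<close>; the next lemma is the dual, where the
  factorization is through \<open>A[1] \<rightarrow> K\<close>.
\<close>

lemma left_truncation_cancel:
  assumes t: "tri A M B u v w" and K: "K \<in> U" and B: "B \<in> V"
    and f: "f \<in> Hom D K A" and g: "g \<in> Hom D K A" and eq: "u \<cdot> f = u \<cdot> g"
  shows "f = g"
proof (rule Cmp_cancel_if_kernel_trivial[OF f g tri_Hom(1)[OF t] eq])
  fix k
  assume k: "k \<in> Hom D K A" "u \<cdot> k = Zero D K M"
  obtain h where h: "h \<in> Hom D (shift_ob K) B" "w \<cdot> h = shift_ar k"
    using tri_shift_kernel[OF t k] .
  have "h = Zero D (shift_ob K) B"
    using orthD[OF h(1) U_shift[OF K] B] .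
  then have "shift_ar k = Zero D (shift_ob K) (shift_ob A)"
    using h(2) Cmp_Zero[OF tri_Hom(3)[OF t]] HomD[OF h(1)] by simp
  then show "k = Zero D K A"
    using shift_eq_Zero_iff k(1) by blast
qed

lemma right_truncation_cancel:
  assumes t: "tri A M B u v w" and K: "K \<in> V" and A: "A \<in> U"
    and f: "f \<in> Hom D B K" and g: "g \<in> Hom D B K" and eq: "f \<cdot> v = g \<cdot> v"
  shows "f = g"
proof (rule Cmp_cancel_if_cokernel_trivial[OF f g tri_Hom(2)[OF t] eq])
  fix k
  assume k: "k \<in> Hom D B K" "k \<cdot> v = Zero D M K"
  obtain h where h: "h \<in> Hom D (shift_ob A) K" "h \<cdot> w = k"
    using tri_coexact[OF tri_rotate[OF t] k] .
  have "h = Zero D (shift_ob A) K"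
    using orthD[OF h(1) U_shift[OF A] K] .
  then show "k = Zero D B K"
    using h(2) Zero_Cmp[OF tri_Hom(3)[OF t]] HomD[OF h(1)] by simp
qed

text \<open>
  With \<open>v = 0\<close> the identity of \<open>M\<close> lifts to a right inverse of \<open>u\<close>, which is two-sided because \<open>u\<close>
  can be cancelled against maps from \<open>U\<close>.
\<close>

lemma left_mem_if_orthogonal:
  assumes M: "M \<in> Ob D" and z: "\<And>B f. \<lbrakk>B \<in> V; f \<in> Hom D M B\<rbrakk> \<Longrightarrow> f = Zero D M B"
  shows "M \<in> U"
proof -
  obtain A B u v w where A: "A \<in> U" and B: "B \<in> V" and t: "tri A M B u v w"
    using truncation[OF M] by blast
  note H = tri_Hom[OF t] and O = tri_Ob[OF t]
  have "v \<cdot> Idn D M = Zero D M B"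
    using z[OF B H(2)] Cmp_Idn[OF H(2)] by simp
  then obtain g where g: "g \<in> Hom D M A" "u \<cdot> g = Idn D M"
    using tri_exact[OF t Idn_Hom[OF M]] by blast
  have "u \<cdot> (g \<cdot> u) = u \<cdot> Idn D A"
    using Cmp_assoc[OF H(1) g(1) H(1)] g(2) Idn_Cmp[OF H(1)] Cmp_Idn[OF H(1)] by simp
  then have "g \<cdot> u = Idn D A"
    using left_truncation_cancel[OF t A B Cmp_Hom[OF H(1) g(1)] Idn_Hom[OF O(1)]] by blast
  then have "isomorphic D A M"
    using isomorphic_if_inverse H(1) g by blast
  then show ?thesis
    using U_iso A M unfolding iso_closed_def by blast
qed

lemma right_mem_if_orthogonal:
  assumes M: "M \<in> Ob D" and z: "\<And>A f. \<lbrakk>A \<in> U; f \<in> Hom D A M\<rbrakk> \<Longrightarrow> f = Zero D A M"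
  shows "M \<in> V"
proof -
  obtain A B u v w where A: "A \<in> U" and B: "B \<in> V" and t: "tri A M B u v w"
    using truncation[OF M] by blast
  note H = tri_Hom[OF t] and O = tri_Ob[OF t]
  have "Idn D M \<cdot> u = Zero D A M"
    using z[OF A H(1)] Idn_Cmp[OF H(1)] by simp
  then obtain g where g: "g \<in> Hom D B M" "g \<cdot> v = Idn D M"
    using tri_coexact[OF t Idn_Hom[OF M]] by blast
  have "(v \<cdot> g) \<cdot> v = Idn D B \<cdot> v"
    using Cmp_assoc[OF H(2) g(1) H(2)] g(2) Idn_Cmp[OF H(2)] Cmp_Idn[OF H(2)] by simp
  then have "v \<cdot> g = Idn D B"
    using right_truncation_cancel[OF t B A Cmp_Hom[OF g(1) H(2)] Idn_Hom[OF O(3)]] by blast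
  then have "isomorphic D B M"
    using isomorphic_if_inverse H(2) g by blast
  then show ?thesis
    using V_iso B M unfolding iso_closed_def by blast
qed

end

locale stable_t_structure = aisle_pair D U V
  for D :: "('o, 'm, 'x) tri_cat_scheme" (structure) and U V :: "'o set" +
  assumes V_shift: "B \<in> V \<Longrightarrow> shift_ob B \<in> V"
begin

text \<open>
  Vanishing of the connecting map is a self-dual condition, so it can stand for both forms of
  splitting: \<open>u\<close> a section and \<open>v\<close> a retraction.
\<close>

lemma splits_iff:
  "t_structure_splits D U V \<longleftrightarrow>
    (\<forall>A \<in> U. \<forall>B \<in> V. \<forall>M u v w. tri A M B u v w \<longrightarrow> w = Zero D B (shift_ob A))"
proof
  assume s: "t_structure_splits D U V"
  show "\<forall>A \<in> U. \<forall>B \<in> V. \<forall>M u v w. tri A M B u v w \<longrightarrow> w = Zero D B (shift_ob A)"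
  proof (intro ballI allI impI)
    fix A B M u v w
    assume "A \<in> U" "B \<in> V" and t: "tri A M B u v w"
    moreover note tri_Ob[OF t] tri_Hom[OF t, THEN HomD]
    ultimately have "is_section D u"
      using s unfolding t_structure_splits_def tri_def by blast
    then show "w = Zero D B (shift_ob A)"
      using tri_section_iff[OF t] by blast
  qed
next
  assume z: "\<forall>A \<in> U. \<forall>B \<in> V. \<forall>M u v w. tri A M B u v w \<longrightarrow> w = Zero D B (shift_ob A)"
  have "is_section D u" if "(u, v, w) \<in> Tri D" "Dom D u \<in> U" "Cod D v \<in> V" for u v w
    using Tri_tri[OF that(1)] that(2,3) z tri_section_iff by blast
  then show "t_structure_splits D U V"
    unfolding t_structure_splits_def by blast
qed

text \<open>
  Rotating the triangle on the cone of \<open>f: B \<rightarrow> A\<close> gives a truncation triangle for that cone with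
  connecting map \<open>-f[1]\<close>, whose right-hand vertex \<open>B[1]\<close> is in \<open>V\<close> because \<open>V\<close> is closed under the shift.
\<close>

lemma splits_iff_orthogonal: "t_structure_splits D U V \<longleftrightarrow> orthogonal D V U"
proof
  assume s: "t_structure_splits D U V"
  show "orthogonal D V U"
    unfolding orthogonal_def
  proof (intro ballI)
    fix B A f
    assume B: "B \<in> V" and A: "A \<in> U" and f: "f \<in> Hom D B A"
    obtain v w where "(f, v, w) \<in> Tri D"
      using TR1_cone f HomD by blast
    then have "tri B A (Cod D v) f v w"
      using Tri_tri HomD[OF f] by metis
    from tri_rotate[OF this] have "Neg D (shift_ar f) = Zero D (shift_ob B) (shift_ob A)"
      using s A V_shift[OF B] splits_iff by blast
    then show "f = Zero D B A"
      using Neg_eq_Zero_iff[OF shift_Hom[OF f]] shift_eq_Zero_iff[OF f] by blast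
  qed
next
  assume "orthogonal D V U"
  then show "t_structure_splits D U V"
    unfolding splits_iff orthogonal_def using tri_Hom(3) U_shift by blast
qed

text \<open>
  The truncation of \<open>M\<close> in \<open>V\<close> is a summand of \<open>M\<close>, included by a map from \<open>V\<close> to \<open>M\<close>. That map is zero,
  so the summand is zero and \<open>M\<close> coincides with its truncation in \<open>U\<close>.
\<close>

lemma splits_imp_left_mem:
  assumes s: "t_structure_splits D U V" and M: "M \<in> Ob D"
    and z: "\<And>B f. \<lbrakk>B \<in> V; f \<in> Hom D B M\<rbrakk> \<Longrightarrow> f = Zero D B M"
  shows "M \<in> U"
proof (rule left_mem_if_orthogonal[OF M])
  fix K f
  assume K: "K \<in> V" and f: "f \<in> Hom D M K"
  obtain A B u v w where A: "A \<in> U" and B: "B \<in> V" and t: "tri A M B u v w"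
    using truncation[OF M] by blast
  note H = tri_Hom[OF t] and O = tri_Ob[OF t]
  have KO: "K \<in> Ob D"
    using K V_Ob by blast
  obtain s where s: "s \<in> Hom D B M" "v \<cdot> s = Idn D B"
    using s A B t splits_iff tri_retraction_iff[OF t] is_retraction_iff[OF H(2)] by blast
  have i: "Idn D B = Zero D B B"
    using s z[OF B s(1)] Cmp_Zero[OF H(2) O(3)] by simp
  have "f \<cdot> u = Zero D A K"
    using orthD[OF Cmp_Hom[OF H(1) f] A K] .
  then obtain g where g: "g \<in> Hom D B K" "g \<cdot> v = f"
    using tri_coexact[OF t f] by blast
  have "g = Zero D B K"
    using Cmp_Idn[OF g(1)] i Cmp_Zero[OF g(1) O(3)] by simp
  then show "f = Zero D M K"
    using g(2) Zero_Cmp[OF H(2) KO] by simp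
qed

lemma splits_imp_right_mem:
  assumes s: "t_structure_splits D U V" and M: "M \<in> Ob D"
    and z: "\<And>A f. \<lbrakk>A \<in> U; f \<in> Hom D M A\<rbrakk> \<Longrightarrow> f = Zero D M A"
  shows "M \<in> V"
proof (rule right_mem_if_orthogonal[OF M])
  fix K f
  assume K: "K \<in> U" and f: "f \<in> Hom D K M"
  obtain A B u v w where A: "A \<in> U" and B: "B \<in> V" and t: "tri A M B u v w"
    using truncation[OF M] by blast
  note H = tri_Hom[OF t] and O = tri_Ob[OF t]
  have KO: "K \<in> Ob D"
    using K U_Ob by blast
  obtain r where r: "r \<in> Hom D M A" "r \<cdot> u = Idn D A"
    using s A B t splits_iff tri_section_iff[OF t] is_section_iff[OF H(1)] by blast
  have i: "Idn D A = Zero D A A"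
    using r z[OF A r(1)] Zero_Cmp[OF H(1) O(1)] by simp
  have "v \<cdot> f = Zero D K B"
    using orthD[OF Cmp_Hom[OF f H(2)] K B] .
  then obtain g where g: "g \<in> Hom D K A" "u \<cdot> g = f"
    using tri_exact[OF t f] by blast
  have "g = Zero D K A"
    using Idn_Cmp[OF g(1)] i Zero_Cmp[OF g(1) O(1)] by simp
  then show "f = Zero D K M"
    using g(2) Cmp_Zero[OF H(1) KO] by simp
qed

end

context triangulated_category
begin

lemma unshift_iso:
  assumes "B \<in> Ob D"
  shows "fob (Unshift D) B \<in> Ob D" and "isomorphic D (shift_ob (fob (Unshift D) B)) B"
proof -
  obtain \<psi> where "nat_isomorphism D D (comp_func (Shift D) (Unshift D)) id_func \<psi>"
    using Shift_Unshift by blast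
  then interpret \<psi>: nat_isomorphism D D "comp_func (Shift D) (Unshift D)" id_func \<psi> .
  show "fob (Unshift D) B \<in> Ob D"
    using cat_functor.fob_Ob[OF Unshift_functor assms] .
  show "isomorphic D (shift_ob (fob (Unshift D) B)) B"
    using \<psi>.component_Hom[OF assms] \<psi>.component_iso[OF assms]
    unfolding isomorphic_def by (auto simp: comp_func_def id_func_def)
qed

lemma shift_reflects_isomorphic:
  assumes A: "A \<in> Ob D" and B: "B \<in> Ob D" and iso: "isomorphic D (shift_ob A) (shift_ob B)"
  shows "isomorphic D A B"
proof -
  obtain h k where h: "h \<in> Hom D (shift_ob A) (shift_ob B)" and k: "k \<in> Hom D (shift_ob B) (shift_ob A)"
    and kh: "k \<cdot> h = Idn D (shift_ob A)" and hk: "h \<cdot> k = Idn D (shift_ob B)"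
    using iso unfolding isomorphic_def using is_isomorphism_iff by blast
  obtain f where f: "f \<in> Hom D A B" "shift_ar f = h"
    using shift_full[OF A B h] .
  obtain g where g: "g \<in> Hom D B A" "shift_ar g = k"
    using shift_full[OF B A k] .
  have "shift_ar (g \<cdot> f) = shift_ar (Idn D A)"
    using shift_Cmp[OF f(1) g(1)] f(2) g(2) kh shift_Idn[OF A] by simp
  then have "g \<cdot> f = Idn D A"
    using shift_faithful[OF Cmp_Hom[OF f(1) g(1)] Idn_Hom[OF A]] by blast
  moreover have "shift_ar (f \<cdot> g) = shift_ar (Idn D B)"
    using shift_Cmp[OF g(1) f(1)] f(2) g(2) hk shift_Idn[OF B] by simp
  then have "f \<cdot> g = Idn D B"
    using shift_faithful[OF Cmp_Hom[OF g(1) f(1)] Idn_Hom[OF B]] by blast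
  ultimately show ?thesis
    using isomorphic_if_inverse f(1) g(1) by blast
qed

lemma subset_shifted:
  assumes "V \<subseteq> Ob D" and "\<forall>B \<in> V. fob (Unshift D) B \<in> V"
  shows "V \<subseteq> shifted D V"
  using assms unshift_iso unfolding shifted_def by blast

text \<open>
  If \<open>A\<close> is in \<open>V[1]\<close> then so is \<open>A[1]\<close>, that is, \<open>A[1] \<cong> B[1]\<close> with \<open>B\<close> in \<open>V\<close>, and \<open>A \<cong> B\<close>. For a TTF
  triple the closure hypothesis holds because \<open>V[1] = Y\<close> is also the left half of a t-structure.
\<close>

lemma shifted_eq_if_shift_closed:
  assumes "V \<subseteq> Ob D" and "iso_closed D V" and "\<forall>B \<in> V. fob (Unshift D) B \<in> V"
    and closed: "\<forall>B \<in> shifted D V. shift_ob B \<in> shifted D V"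
  shows "shifted D V = V"
proof
  show "V \<subseteq> shifted D V"
    using subset_shifted assms by blast
  show "shifted D V \<subseteq> V"
  proof
    fix A
    assume A: "A \<in> shifted D V"
    then obtain B where B: "B \<in> V" "isomorphic D (shift_ob B) (shift_ob A)"
      using closed unfolding shifted_def by blast
    moreover have "A \<in> Ob D"
      using A unfolding shifted_def by blast
    ultimately have "isomorphic D B A"
      using shift_reflects_isomorphic assms(1) by blast
    then show "A \<in> V"
      using assms(2) B(1) \<open>A \<in> Ob D\<close> unfolding iso_closed_def by blast
  qed
qed

text \<open>A map \<open>A \<rightarrow> B[1]\<close> corresponds to a map \<open>A[-1] \<rightarrow> B\<close>, and \<open>A[-1]\<close> lies in \<open>U\<close>.\<close>

lemma orthogonal_shift:
  assumes U: "U \<subseteq> Ob D" and unshift: "\<forall>A \<in> U. fob (Unshift D) A \<in> U"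
    and V: "V \<subseteq> Ob D" and orth: "orthogonal D U V"
    and A: "A \<in> U" and B: "B \<in> V" and f: "f \<in> Hom D A (shift_ob B)"
  shows "f = Zero D A (shift_ob B)"
proof -
  let ?A = "fob (Unshift D) A"
  have O: "A \<in> Ob D" "?A \<in> Ob D" "B \<in> Ob D"
    using A B U V unshift by blast+
  obtain e d where e: "e \<in> Hom D (shift_ob ?A) A" and d: "d \<in> Hom D A (shift_ob ?A)" "e \<cdot> d = Idn D A"
    using unshift_iso(2)[OF O(1)] unfolding isomorphic_def using is_isomorphism_iff by blast
  obtain g where g: "g \<in> Hom D ?A B" "shift_ar g = f \<cdot> e"
    using shift_full[OF O(2,3) Cmp_Hom[OF e f]] .
  have "g = Zero D ?A B"
    using orth g(1) A B unshift unfolding orthogonal_def by blast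
  then have "f \<cdot> e = Zero D (shift_ob ?A) (shift_ob B)"
    using g(2) shift_Zero[OF O(2,3)] by simp
  also have "\<dots> = Zero D A (shift_ob B) \<cdot> e"
    using Zero_Cmp[OF e shift_Ob[OF O(3)]] by simp
  finally show ?thesis
    using retraction_cancel[OF e d f Zero_Hom] O(1) shift_Ob[OF O(3)] by blast
qed

lemma t_structureE:
  assumes "t_structure D U W"
  obtains V where "W = shifted D V" "aisle_pair D U V" "\<forall>B \<in> V. fob (Unshift D) B \<in> V"
proof -
  obtain V where V: "W = shifted D V" "U \<subseteq> Ob D" "V \<subseteq> Ob D" "iso_closed D U" "iso_closed D V"
    "\<forall>A \<in> U. \<forall>B \<in> V. Hom D A B = {Zero D A B}"
    "\<forall>A \<in> U. shift_ob A \<in> U" "\<forall>B \<in> V. fob (Unshift D) B \<in> V"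
    and T: "\<forall>M \<in> Ob D. \<exists>u v w. (u, v, w) \<in> Tri D \<and> Dom D u \<in> U \<and> Cod D u = M \<and> Cod D v \<in> V"
    using assms unfolding t_structure_def by blast
  have "orthogonal D U V"
    using V(6) unfolding orthogonal_def by blast
  moreover have "\<exists>A \<in> U. \<exists>B \<in> V. \<exists>u v w. tri A M B u v w" if M: "M \<in> Ob D" for M
  proof -
    obtain u v w where "(u, v, w) \<in> Tri D" "Dom D u \<in> U" "Cod D u = M" "Cod D v \<in> V"
      using T M by blast
    then show ?thesis
      using Tri_tri[of u v w] by blast
  qed
  ultimately have "aisle_pair D U V"
    using V(2-5,7) by unfold_locales blast+
  then show ?thesis
    using that V(1,8) by blast
qed

text \<open>
  The middle class \<open>Y\<close> is closed under \<open>?[1]\<close> as an aisle and under \<open>?[-1]\<close> as a coaisle. This makes its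
  right orthogonal \<open>W\<close> closed under \<open>?[1]\<close>, so that passing from \<open>W\<close> to \<open>Z = W[1]\<close> changes nothing.
\<close>

lemma TTF_triple_stable:
  assumes "triangulated_TTF_triple D X Y Z"
  shows "stable_t_structure D X Y" and "stable_t_structure D Y Z"
proof -
  have XY: "t_structure D X Y" and YZ: "t_structure D Y Z"
    using assms unfolding triangulated_TTF_triple_def by blast+
  obtain V where V: "Y = shifted D V" "aisle_pair D X V" "\<forall>B \<in> V. fob (Unshift D) B \<in> V"
    using t_structureE[OF XY] by blast
  obtain W where W: "Z = shifted D W" "aisle_pair D Y W" "\<forall>B \<in> W. fob (Unshift D) B \<in> W"
    using t_structureE[OF YZ] by blast
  interpret XV: aisle_pair D X V
    by (rule V(2))
  interpret YW: aisle_pair D Y W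
    by (rule W(2))
  have YV: "Y = V"
    using shifted_eq_if_shift_closed[OF XV.V_Ob XV.V_iso V(3)] YW.U_shift V(1) by simp
  show "stable_t_structure D X Y"
    using V(2) YW.U_shift unfolding YV stable_t_structure_def stable_t_structure_axioms_def
    by blast
  have W_shift: "shift_ob B \<in> W" if B: "B \<in> W" for B
  proof (rule YW.right_mem_if_orthogonal)
    show "shift_ob B \<in> Ob D"
      using B YW.V_Ob shift_Ob by blast
    show "f = Zero D A (shift_ob B)" if "A \<in> Y" "f \<in> Hom D A (shift_ob B)" for A f
      using orthogonal_shift[OF YW.U_Ob _ YW.V_Ob YW.orth that(1) B that(2)] V(3) YV by blast
  qed
  have "shifted D W \<subseteq> W"
    using W_shift YW.V_iso unfolding shifted_def iso_closed_def by blast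
  then have "Z = W"
    using subset_shifted[OF YW.V_Ob W(3)] W(1) by blast
  then show "stable_t_structure D Y Z"
    using W(2) W_shift unfolding stable_t_structure_def stable_t_structure_axioms_def by blast
qed

end

section \<open>Reflections and coreflections\<close>

text \<open>
  The universal properties of the counit and the unit at a single object; these are
  what is compared with truncation triangles.
\<close>

definition coreflection :: "('o, 'm, 'x) cat_scheme \<Rightarrow> 'o set \<Rightarrow> 'o \<Rightarrow> 'o \<Rightarrow> 'm \<Rightarrow> bool" where
  "coreflection C Y M A k \<longleftrightarrow> A \<in> Y \<and> k \<in> Hom C A M \<and>
    (\<forall>K \<in> Y. \<forall>f \<in> Hom C K M. \<exists>!g. g \<in> Hom C K A \<and> k \<cdot>\<^bsub>C\<^esub> g = f)"

definition reflection :: "('o, 'm, 'x) cat_scheme \<Rightarrow> 'o set \<Rightarrow> 'o \<Rightarrow> 'o \<Rightarrow> 'm \<Rightarrow> bool" where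
  "reflection C Y M B e \<longleftrightarrow> B \<in> Y \<and> e \<in> Hom C M B \<and>
    (\<forall>K \<in> Y. \<forall>f \<in> Hom C M K. \<exists>!g. g \<in> Hom C B K \<and> g \<cdot>\<^bsub>C\<^esub> e = f)"

lemma Hom_full_subcat: "Hom (full_subcat C S) A B = {f \<in> Hom C A B. A \<in> S \<and> B \<in> S}"
  unfolding Hom_def full_subcat_def by auto

lemma counit_coreflection:
  assumes adj: "adjunction (full_subcat C Y) C id_func R \<alpha> \<delta>" and M: "M \<in> Ob C"
  shows "coreflection C Y M (fob R M) (\<delta> M)"
proof -
  interpret C: category C
    using adj unfolding adjunction_def cat_functor_def by blast
  interpret adjunction "full_subcat C Y" C id_func R \<alpha> \<delta>
    by (rule adj)
  have RY: "fob R M \<in> Y"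
    using R.fob_Ob[OF M] by (simp add: full_subcat_def)
  have \<delta>: "\<delta> M \<in> Hom C (fob R M) M"
    using counit.component_Hom[OF M] by (simp add: comp_func_def id_func_def)
  have "\<exists>!g. g \<in> Hom C K (fob R M) \<and> \<delta> M \<cdot>\<^bsub>C\<^esub> g = f" if K: "K \<in> Y" and f: "f \<in> Hom C K M" for K f
  proof -
    have KO: "K \<in> Ob C"
      using C.HomD[OF f] by blast
    have KS: "K \<in> Ob (full_subcat C Y)"
      using K by (simp add: full_subcat_def)
    have \<alpha>: "\<alpha> K \<in> Hom C K (fob R K)"
      using unit.component_Hom[OF KS] by (simp add: comp_func_def id_func_def Hom_full_subcat)
    have Rf: "far R f \<in> Hom C (fob R K) (fob R M)"
      using R.far_Hom[OF f] by (simp add: Hom_full_subcat)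
    have \<delta>K: "\<delta> K \<in> Hom C (fob R K) K"
      using counit.component_Hom[OF KO] by (simp add: comp_func_def id_func_def)
    have g: "far R f \<cdot>\<^bsub>C\<^esub> \<alpha> K \<in> Hom C K (fob R M)"
      using C.Cmp_Hom[OF \<alpha> Rf] .
    have nat: "\<delta> M \<cdot>\<^bsub>C\<^esub> far R f = f \<cdot>\<^bsub>C\<^esub> \<delta> K"
      using counit.naturality[OF f] by (simp add: comp_func_def id_func_def)
    have "\<delta> M \<cdot>\<^bsub>C\<^esub> (far R f \<cdot>\<^bsub>C\<^esub> \<alpha> K) = (f \<cdot>\<^bsub>C\<^esub> \<delta> K) \<cdot>\<^bsub>C\<^esub> \<alpha> K"
      using C.Cmp_assoc[OF \<alpha> Rf \<delta>] nat by simp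
    also have "\<dots> = f"
      using C.Cmp_assoc[OF \<alpha> \<delta>K f] triangle_L[OF KS] C.Cmp_Idn[OF f]
      by (simp add: id_func_def)
    finally have ex: "\<delta> M \<cdot>\<^bsub>C\<^esub> (far R f \<cdot>\<^bsub>C\<^esub> \<alpha> K) = f" .
    have "h = far R f \<cdot>\<^bsub>C\<^esub> \<alpha> K" if h: "h \<in> Hom C K (fob R M)" and eq: "\<delta> M \<cdot>\<^bsub>C\<^esub> h = f" for h
    proof -
      have hS: "h \<in> Hom (full_subcat C Y) K (fob R M)"
        using h K RY by (simp add: Hom_full_subcat)
      have \<alpha>M: "\<alpha> (fob R M) \<in> Hom C (fob R M) (fob R (fob R M))"
        using unit.component_Hom[OF R.fob_Ob[OF M]]
        by (simp add: comp_func_def id_func_def Hom_full_subcat)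
      have Rh: "far R h \<in> Hom C (fob R K) (fob R (fob R M))"
        using R.far_Hom[OF h] by (simp add: Hom_full_subcat)
      have R\<delta>: "far R (\<delta> M) \<in> Hom C (fob R (fob R M)) (fob R M)"
        using R.far_Hom[OF \<delta>] by (simp add: Hom_full_subcat)
      have nat: "\<alpha> (fob R M) \<cdot>\<^bsub>C\<^esub> h = far R h \<cdot>\<^bsub>C\<^esub> \<alpha> K"
        using unit.naturality[OF hS] by (simp add: comp_func_def id_func_def full_subcat_def)
      have "far R f \<cdot>\<^bsub>C\<^esub> \<alpha> K = (far R (\<delta> M) \<cdot>\<^bsub>C\<^esub> far R h) \<cdot>\<^bsub>C\<^esub> \<alpha> K"
        using R.far_Cmp[OF h \<delta>] eq by (simp add: full_subcat_def)
      also have "\<dots> = (far R (\<delta> M) \<cdot>\<^bsub>C\<^esub> \<alpha> (fob R M)) \<cdot>\<^bsub>C\<^esub> h"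
        using C.Cmp_assoc[OF \<alpha> Rh R\<delta>] C.Cmp_assoc[OF h \<alpha>M R\<delta>] nat by simp
      also have "\<dots> = h"
        using triangle_R[OF M] C.Idn_Cmp[OF h] by (simp add: full_subcat_def)
      finally show ?thesis
        by simp
    qed
    with g ex show ?thesis
      by blast
  qed
  with RY \<delta> show ?thesis
    unfolding coreflection_def by blast
qed

lemma unit_reflection:
  assumes adj: "adjunction C (full_subcat C Y) L id_func \<eta> \<beta>" and M: "M \<in> Ob C"
  shows "reflection C Y M (fob L M) (\<eta> M)"
proof -
  interpret C: category C
    using adj unfolding adjunction_def cat_functor_def by blast
  interpret adjunction C "full_subcat C Y" L id_func \<eta> \<beta>
    by (rule adj)
  have LY: "fob L M \<in> Y"
    using L.fob_Ob[OF M] by (simp add: full_subcat_def)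
  have \<eta>: "\<eta> M \<in> Hom C M (fob L M)"
    using unit.component_Hom[OF M] by (simp add: comp_func_def id_func_def)
  have "\<exists>!g. g \<in> Hom C (fob L M) K \<and> g \<cdot>\<^bsub>C\<^esub> \<eta> M = f" if K: "K \<in> Y" and f: "f \<in> Hom C M K" for K f
  proof -
    have KO: "K \<in> Ob C"
      using C.HomD[OF f] by blast
    have KS: "K \<in> Ob (full_subcat C Y)"
      using K by (simp add: full_subcat_def)
    have \<beta>: "\<beta> K \<in> Hom C (fob L K) K"
      using counit.component_Hom[OF KS] by (simp add: comp_func_def id_func_def Hom_full_subcat)
    have Lf: "far L f \<in> Hom C (fob L M) (fob L K)"
      using L.far_Hom[OF f] by (simp add: Hom_full_subcat)
    have \<eta>K: "\<eta> K \<in> Hom C K (fob L K)"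
      using unit.component_Hom[OF KO] by (simp add: comp_func_def id_func_def)
    have g: "\<beta> K \<cdot>\<^bsub>C\<^esub> far L f \<in> Hom C (fob L M) K"
      using C.Cmp_Hom[OF Lf \<beta>] .
    have nat: "far L f \<cdot>\<^bsub>C\<^esub> \<eta> M = \<eta> K \<cdot>\<^bsub>C\<^esub> f"
      using unit.naturality[OF f] by (simp add: comp_func_def id_func_def)
    have "(\<beta> K \<cdot>\<^bsub>C\<^esub> far L f) \<cdot>\<^bsub>C\<^esub> \<eta> M = \<beta> K \<cdot>\<^bsub>C\<^esub> (\<eta> K \<cdot>\<^bsub>C\<^esub> f)"
      using C.Cmp_assoc[OF \<eta> Lf \<beta>] nat by simp
    also have "\<dots> = f"
      using C.Cmp_assoc[OF f \<eta>K \<beta>] triangle_R[OF KS] C.Idn_Cmp[OF f]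
      by (simp add: id_func_def)
    finally have ex: "(\<beta> K \<cdot>\<^bsub>C\<^esub> far L f) \<cdot>\<^bsub>C\<^esub> \<eta> M = f" .
    have "h = \<beta> K \<cdot>\<^bsub>C\<^esub> far L f" if h: "h \<in> Hom C (fob L M) K" and eq: "h \<cdot>\<^bsub>C\<^esub> \<eta> M = f" for h
    proof -
      have hS: "h \<in> Hom (full_subcat C Y) (fob L M) K"
        using h K LY by (simp add: Hom_full_subcat)
      have \<beta>M: "\<beta> (fob L M) \<in> Hom C (fob L (fob L M)) (fob L M)"
        using counit.component_Hom[OF L.fob_Ob[OF M]]
        by (simp add: comp_func_def id_func_def Hom_full_subcat)
      have Lh: "far L h \<in> Hom C (fob L (fob L M)) (fob L K)"
        using L.far_Hom[OF h] by (simp add: Hom_full_subcat)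
      have L\<eta>: "far L (\<eta> M) \<in> Hom C (fob L M) (fob L (fob L M))"
        using L.far_Hom[OF \<eta>] by (simp add: Hom_full_subcat)
      have nat: "\<beta> K \<cdot>\<^bsub>C\<^esub> far L h = h \<cdot>\<^bsub>C\<^esub> \<beta> (fob L M)"
        using counit.naturality[OF hS] by (simp add: comp_func_def id_func_def full_subcat_def)
      have "\<beta> K \<cdot>\<^bsub>C\<^esub> far L f = \<beta> K \<cdot>\<^bsub>C\<^esub> (far L h \<cdot>\<^bsub>C\<^esub> far L (\<eta> M))"
        using L.far_Cmp[OF \<eta> h] eq by (simp add: full_subcat_def)
      also have "\<dots> = h \<cdot>\<^bsub>C\<^esub> (\<beta> (fob L M) \<cdot>\<^bsub>C\<^esub> far L (\<eta> M))"
        using C.Cmp_assoc[OF L\<eta> Lh \<beta>] C.Cmp_assoc[OF L\<eta> \<beta>M h] nat by simp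
      also have "\<dots> = h"
        using triangle_L[OF M] C.Cmp_Idn[OF h] by (simp add: full_subcat_def)
      finally show ?thesis
        by simp
    qed
    with g ex show ?thesis
      by blast
  qed
  with LY \<eta> show ?thesis
    unfolding reflection_def by blast
qed

context stable_t_structure
begin

text \<open>
  The coreflection \<open>k\<close> and the map \<open>u\<close> of a truncation triangle factor through each other,
  \<open>u = k b\<close> and \<open>k = u a\<close>. As \<open>u\<close> can be cancelled, \<open>a b = 1\<close>, and \<open>a\<close> carries a left inverse of \<open>k\<close> to
  one of \<open>u\<close>.
\<close>

lemma splits_if_coreflections_sections:
  assumes "\<And>M. M \<in> Ob D \<Longrightarrow> \<exists>R k. coreflection D U M R k \<and> is_section D k"
  shows "t_structure_splits D U V"
  unfolding splits_iff
proof (intro ballI allI impI)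
  fix A B M u v w
  assume A: "A \<in> U" and B: "B \<in> V" and t: "tri A M B u v w"
  note H = tri_Hom[OF t] and O = tri_Ob[OF t]
  obtain R k where R: "coreflection D U M R k" and sec: "is_section D k"
    using assms O(2) by blast
  have RU: "R \<in> U" and k: "k \<in> Hom D R M"
    using R unfolding coreflection_def by blast+
  obtain r where r: "r \<in> Hom D M R" "r \<cdot> k = Idn D R"
    using sec is_section_iff[OF k] by blast
  obtain b where b: "b \<in> Hom D A R" "k \<cdot> b = u"
    using R A H(1) unfolding coreflection_def by blast
  have "v \<cdot> k = Zero D R B"
    using orthD[OF Cmp_Hom[OF k H(2)] RU B] .
  then obtain a where a: "a \<in> Hom D R A" "u \<cdot> a = k"
    using tri_exact[OF t k] by blast
  have ab: "a \<cdot> b \<in> Hom D A A"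
    using Cmp_Hom[OF b(1) a(1)] .
  have "u \<cdot> (a \<cdot> b) = u \<cdot> Idn D A"
    using Cmp_assoc[OF b(1) a(1) H(1)] a(2) b(2) Cmp_Idn[OF H(1)] by simp
  then have ab_id: "a \<cdot> b = Idn D A"
    using left_truncation_cancel[OF t A B ab Idn_Hom[OF O(1)]] by blast
  have "r \<cdot> u = b"
    using Cmp_assoc[OF b(1) k r(1)] r(2) b(2) Idn_Cmp[OF b(1)] by simp
  then have "(a \<cdot> r) \<cdot> u = Idn D A"
    using Cmp_assoc[OF H(1) r(1) a(1)] ab_id by simp
  then have "is_section D u"
    using is_section_iff[OF H(1)] Cmp_Hom[OF r(1) a(1)] by blast
  then show "w = Zero D B (shift_ob A)"
    using tri_section_iff[OF t] by blast
qed

lemma reflection_truncation_iso: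
  assumes t: "tri A M B u v w" and A: "A \<in> U" and B: "B \<in> V" and L: "reflection D V M L e"
  obtains a b where "a \<in> Hom D L B" "b \<in> Hom D B L" "a \<cdot> e = v" "b \<cdot> v = e"
    "a \<cdot> b = Idn D B" "b \<cdot> a = Idn D L"
proof -
  note H = tri_Hom[OF t] and O = tri_Ob[OF t]
  have LV: "L \<in> V" and e: "e \<in> Hom D M L"
    using L unfolding reflection_def by blast+
  obtain a where a: "a \<in> Hom D L B" "a \<cdot> e = v"
    using L B H(2) unfolding reflection_def by blast
  have "e \<cdot> u = Zero D A L"
    using orthD[OF Cmp_Hom[OF H(1) e] A LV] .
  then obtain b where b: "b \<in> Hom D B L" "b \<cdot> v = e"
    using tri_coexact[OF t e] by blast
  have "(a \<cdot> b) \<cdot> v = Idn D B \<cdot> v"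
    using Cmp_assoc[OF H(2) b(1) a(1)] a(2) b(2) Idn_Cmp[OF H(2)] by simp
  then have "a \<cdot> b = Idn D B"
    using right_truncation_cancel[OF t B A Cmp_Hom[OF b(1) a(1)] Idn_Hom[OF O(3)]] by blast
  moreover have "(b \<cdot> a) \<cdot> e = e"
    using Cmp_assoc[OF e a(1) b(1)] a(2) b(2) by simp
  moreover have "Idn D L \<cdot> e = e"
    using Idn_Cmp[OF e] .
  ultimately have "b \<cdot> a = Idn D L"
    using L LV e Cmp_Hom[OF a(1) b(1)] Idn_Hom HomD[OF e] unfolding reflection_def by blast
  then show ?thesis
    using that a b \<open>a \<cdot> b = Idn D B\<close> by blast
qed

lemma splits_if_reflections_retractions:
  assumes "\<And>M. M \<in> Ob D \<Longrightarrow> \<exists>L e. reflection D V M L e \<and> is_retraction D e"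
  shows "t_structure_splits D U V"
  unfolding splits_iff
proof (intro ballI allI impI)
  fix A B M u v w
  assume A: "A \<in> U" and B: "B \<in> V" and t: "tri A M B u v w"
  note H = tri_Hom[OF t] and O = tri_Ob[OF t]
  obtain L e where L: "reflection D V M L e" and ret: "is_retraction D e"
    using assms O(2) by blast
  have e: "e \<in> Hom D M L"
    using L unfolding reflection_def by blast
  obtain s where s: "s \<in> Hom D L M" "e \<cdot> s = Idn D L"
    using ret is_retraction_iff[OF e] by blast
  obtain a b where a: "a \<in> Hom D L B" "a \<cdot> e = v" and b: "b \<in> Hom D B L" "a \<cdot> b = Idn D B"
    using reflection_truncation_iso[OF t A B L] by blast
  have "v \<cdot> s = a"
    using Cmp_assoc[OF s(1) e a(1)] a(2) s(2) Cmp_Idn[OF a(1)] by simp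
  then have "v \<cdot> (s \<cdot> b) = Idn D B"
    using Cmp_assoc[OF b(1) s(1) H(2)] b(2) by simp
  then have "is_retraction D v"
    using is_retraction_iff[OF H(2)] Cmp_Hom[OF b(1) s(1)] by blast
  then show "w = Zero D B (shift_ob A)"
    using tri_retraction_iff[OF t] by blast
qed

text \<open>
  The connecting map goes from \<open>V\<close> to \<open>U\<close> and vanishes, so \<open>v\<close> has a section \<open>s\<close>. Identify \<open>e\<close> with \<open>v\<close>
  via the mutually inverse \<open>a\<close> and \<open>b\<close>, and factor \<open>s = k c\<close>; then \<open>c a\<close> is the inverse of \<open>e k\<close>. On
  one side this is \<open>v s = 1\<close>. On the other side it rests on \<open>s v k = k\<close>: the difference of the two
  maps is killed by \<open>v\<close>, hence factors through a map from \<open>V\<close> to \<open>U\<close>.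
\<close>

lemma coreflection_reflection_iso:
  assumes VU: "orthogonal D V U" and M: "M \<in> Ob D"
    and R: "coreflection D V M R k" and L: "reflection D V M L e"
  shows "is_isomorphism D (e \<cdot> k)"
proof -
  obtain A B u v w where A: "A \<in> U" and B: "B \<in> V" and t: "tri A M B u v w"
    using truncation[OF M] by blast
  note H = tri_Hom[OF t] and O = tri_Ob[OF t]
  have RV: "R \<in> V" and k: "k \<in> Hom D R M" and LV: "L \<in> V" and e: "e \<in> Hom D M L"
    using R L unfolding coreflection_def reflection_def by blast+
  have RO: "R \<in> Ob D"
    using HomD k by blast
  obtain s where s: "s \<in> Hom D B M" "v \<cdot> s = Idn D B"
    using VU A B t splits_iff_orthogonal splits_iff tri_retraction_iff[OF t]
      is_retraction_iff[OF H(2)] by blast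
  obtain c where c: "c \<in> Hom D B R" "k \<cdot> c = s"
    using R B s(1) unfolding coreflection_def by blast
  obtain a b where a: "a \<in> Hom D L B" "a \<cdot> e = v" and b: "b \<in> Hom D B L" "b \<cdot> v = e"
    and ba: "b \<cdot> a = Idn D L"
    using reflection_truncation_iso[OF t A B L] by blast
  have ek: "e \<cdot> k \<in> Hom D R L" and vk: "v \<cdot> k \<in> Hom D R B" and ca: "c \<cdot> a \<in> Hom D L R"
    using Cmp_Hom k e H(2) c(1) a(1) by blast+
  have "k \<cdot> (c \<cdot> a) = s \<cdot> a"
    using Cmp_assoc[OF a(1) c(1) k] c(2) by simp
  moreover have "e \<cdot> (s \<cdot> a) = Idn D L"
  proof -
    have sa: "s \<cdot> a \<in> Hom D L M"
      using Cmp_Hom[OF a(1) s(1)] .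
    have "e \<cdot> (s \<cdot> a) = b \<cdot> (v \<cdot> (s \<cdot> a))"
      using Cmp_assoc[OF sa H(2) b(1)] b(2) by simp
    also have "v \<cdot> (s \<cdot> a) = a"
      using Cmp_assoc[OF a(1) s(1) H(2)] s(2) Idn_Cmp[OF a(1)] by simp
    finally show ?thesis
      using ba by simp
  qed
  ultimately have right: "(e \<cdot> k) \<cdot> (c \<cdot> a) = Idn D L"
    using Cmp_assoc[OF ca k e] by simp
  have svk: "s \<cdot> (v \<cdot> k) = k"
  proof (rule Cmp_cancel_if_kernel_trivial[OF Cmp_Hom[OF vk s(1)] k H(2)])
    show "v \<cdot> (s \<cdot> (v \<cdot> k)) = v \<cdot> k"
      using Cmp_assoc[OF vk s(1) H(2)] s(2) Idn_Cmp[OF vk] by simp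
  next
    fix f
    assume f: "f \<in> Hom D R M" "v \<cdot> f = Zero D R B"
    obtain g where g: "g \<in> Hom D R A" "u \<cdot> g = f"
      using tri_exact[OF t f] .
    have "g = Zero D R A"
      using VU RV A g(1) unfolding orthogonal_def by blast
    then show "f = Zero D R M"
      using g(2) Cmp_Zero[OF H(1) RO] by simp
  qed
  have "k \<cdot> (c \<cdot> (v \<cdot> k)) = k"
    using Cmp_assoc[OF vk c(1) k] c(2) svk by simp
  moreover have "k \<cdot> Idn D R = k"
    using Cmp_Idn[OF k] .
  ultimately have cvk: "c \<cdot> (v \<cdot> k) = Idn D R"
    using R RV k Cmp_Hom[OF vk c(1)] Idn_Hom[OF RO] unfolding coreflection_def by blast
  have "(c \<cdot> a) \<cdot> (e \<cdot> k) = c \<cdot> (a \<cdot> (e \<cdot> k))"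
    using Cmp_assoc[OF ek a(1) c(1)] .
  also have "a \<cdot> (e \<cdot> k) = v \<cdot> k"
    using Cmp_assoc[OF k e a(1)] a(2) by simp
  finally have "(c \<cdot> a) \<cdot> (e \<cdot> k) = Idn D R"
    using cvk by simp
  then show ?thesis
    using right is_isomorphism_iff[OF ek] ca by blast
qed

end

section \<open>Split TTF triples\<close>

theorem proposition1p6p8:
  fixes D :: "('o, 'm) tri_cat"
    and X Y Z :: "'o set"
    and \<tau>R \<tau>L :: "('o, 'm, 'o, 'm) func"
    and \<alpha> \<delta> \<eta> \<beta> :: "'o \<Rightarrow> 'm"
  assumes "triangulated_category D"
    and "triangulated_TTF_triple D X Y Z"
    and "adjunction (full_subcat D Y) D inclusion \<tau>R \<alpha> \<delta>"
    and "adjunction D (full_subcat D Y) \<tau>L inclusion \<eta> \<beta>"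
  shows "(t_structure_splits D X Y \<longleftrightarrow> t_structure_splits D Y Z) \<and>
    (t_structure_splits D Y Z \<longleftrightarrow> X = Z) \<and>
    (X = Z \<longleftrightarrow> (\<forall>M \<in> Ob D. is_isomorphism D (\<eta> M \<cdot>\<^bsub>D\<^esub> \<delta> M))) \<and>
    ((\<forall>M \<in> Ob D. is_isomorphism D (\<eta> M \<cdot>\<^bsub>D\<^esub> \<delta> M)) \<longleftrightarrow>
      (\<forall>M \<in> Ob D. is_section D (\<eta> M \<cdot>\<^bsub>D\<^esub> \<delta> M))) \<and>
    ((\<forall>M \<in> Ob D. is_section D (\<eta> M \<cdot>\<^bsub>D\<^esub> \<delta> M)) \<longleftrightarrow>
      (\<forall>M \<in> Ob D. is_retraction D (\<eta> M \<cdot>\<^bsub>D\<^esub> \<delta> M)))"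
proof -
  interpret triangulated_category D
    by (rule assms(1))
  interpret XY: stable_t_structure D X Y
    by (rule TTF_triple_stable(1)[OF assms(2)])
  interpret YZ: stable_t_structure D Y Z
    by (rule TTF_triple_stable(2)[OF assms(2)])
  have \<delta>: "coreflection D Y M (fob \<tau>R M) (\<delta> M)" if "M \<in> Ob D" for M
    using counit_coreflection[OF assms(3) that] .
  have \<eta>: "reflection D Y M (fob \<tau>L M) (\<eta> M)" if "M \<in> Ob D" for M
    using unit_reflection[OF assms(4) that] .
  note homs = \<delta>[unfolded coreflection_def, THEN conjunct2, THEN conjunct1]
    \<eta>[unfolded reflection_def, THEN conjunct2, THEN conjunct1]
  have eq_if_XY: "X = Z" if s: "t_structure_splits D X Y"
  proof
    show "X \<subseteq> Z"
      using YZ.right_mem_if_orthogonal XY.U_Ob s XY.splits_iff_orthogonal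
      unfolding orthogonal_def by blast
    show "Z \<subseteq> X"
      using XY.splits_imp_left_mem[OF s] YZ.V_Ob YZ.orthD by blast
  qed
  have eq_if_YZ: "X = Z" if s: "t_structure_splits D Y Z"
  proof
    show "Z \<subseteq> X"
      using XY.left_mem_if_orthogonal YZ.V_Ob s YZ.splits_iff_orthogonal
      unfolding orthogonal_def by blast
    show "X \<subseteq> Z"
      using YZ.splits_imp_right_mem[OF s] XY.U_Ob XY.orthD by blast
  qed
  have XY_iff: "t_structure_splits D X Y \<longleftrightarrow> X = Z"
    using eq_if_XY XY.splits_iff_orthogonal YZ.orth by blast
  have YZ_iff: "t_structure_splits D Y Z \<longleftrightarrow> X = Z"
    using eq_if_YZ YZ.splits_iff_orthogonal XY.orth by blast
  have iso: "\<forall>M \<in> Ob D. is_isomorphism D (\<eta> M \<cdot>\<^bsub>D\<^esub> \<delta> M)" if "X = Z"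
    using XY.coreflection_reflection_iso \<delta> \<eta> YZ.orth that by blast
  have "X = Z" if s: "\<forall>M \<in> Ob D. is_section D (\<eta> M \<cdot>\<^bsub>D\<^esub> \<delta> M)"
  proof (rule eq_if_YZ, rule YZ.splits_if_coreflections_sections)
    fix M
    assume "M \<in> Ob D"
    then show "\<exists>R k. coreflection D Y M R k \<and> is_section D k"
      using s \<delta> section_of_comp homs by blast
  qed
  moreover have "X = Z" if s: "\<forall>M \<in> Ob D. is_retraction D (\<eta> M \<cdot>\<^bsub>D\<^esub> \<delta> M)"
  proof (rule eq_if_XY, rule XY.splits_if_reflections_retractions)
    fix M
    assume "M \<in> Ob D"
    then show "\<exists>L e. reflection D Y M L e \<and> is_retraction D e"
      using s \<eta> retraction_of_comp homs by blast
  qed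
  ultimately show ?thesis
    using XY_iff YZ_iff iso is_isomorphism_imp_section is_isomorphism_imp_retraction by blast
qed

end
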